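(* Let $k\in\mathbb N$ and let $\mu$ be a Borel probability measure on $[0,1]^k$ satisfying \[ \dim_{\ell^1}(\mu)>k-\frac{k}{k+1}. \] Then $\mu$ is inhomogeneous convergent Khinchin. If moreover $\mu=\mu_1\times\cdots\times\mu_k$ is a product of Borel probability measures on $[0,1]$ with \[ \dim_{\ell^1}(\mu_j)>1-\frac{1}{k+1}\qquad(1\leqslant j\leqslant k), \] then $\mu$ is inhomogeneous convergent Gallagher.
   Context: $\|x\|$ is the distance from $x\in\mathbb R$ to the nearest integer, $e(x)=e^{2\pi i x}$. For a Borel probability measure $\nu$ on $[0,1]^k$, $\hat\nu({\boldsymbol{\xi}})=\int e(-{\boldsymbol{\xi}}\cdot\mathbf x)\,d\nu(\mathbf x)$ for ${\boldsymbol{\xi}}\in\mathbb Z^k$, and $\dim_{\ell^1}(\nu)=\sup\{s\geqslant0:\sum_{\|{\boldsymbol{\xi}}\|_\infty\leqslant Q}|\hat\nu({\boldsymbol{\xi}})|\ll Q^{k-s}\ (Q\geqslant1)\}$ (with $k=1$ for measures on $[0,1]$). For $\psi:\mathbb N\to[0,1)$ and $\mathbf y\in\mathbb R^k$: $W_k(\psi,\mathbf y)$ is the set of $\mathbf x\in[0,1)^k$ with $\max_j\|nx_j-y_j\|<\psi(n)$ for infinitely many $n\in\mathbb N$; $W_k^\times(\psi,\mathbf y)$ is the set of $\mathbf x\in[0,1)^k$ with $\prod_{j=1}^k\|nx_j-y_j\|<\psi(n)$ for infinitely many $n\in\mathbb N$. A probability measure $\mu$ on $[0,1]^k$ is inhomogeneous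 convergent Khinchin if for every non-increasing $\psi:\mathbb N\to[0,1)$ with $\sum_n\psi(n)^k<\infty$ we have $\mu(W_k(\psi,\mathbf y))=0$ for all $\mathbf y\in\mathbb R^k$; it is inhomogeneous convergent Gallagher if for every non-increasing $\psi:\mathbb N\to[0,1)$ with $\sum_n\psi(n)(\log n)^{k-1}<\infty$ we have $\mu(W^\times_k(\psi,\mathbf y))=0$ for all $\mathbf y\in\mathbb R^k$. *)

theory Defs
  imports "HOL-Probability.Probability"
begin

definition dist_nint :: "real \<Rightarrow> real" where
  "dist_nint x = \<bar>x - real_of_int (round x)\<bar>"

text \<open>Points of R^k are modelled as functions nat => real restricted to the index set {..<k};
  Borel measures on R^k live on the product sigma algebra of PiM {..<k} (\<lambda>_. borel).\<close>

definition borel_prob_cube :: "nat \<Rightarrow> (nat \<Rightarrow> real) measure \<Rightarrow> bool" where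
  "borel_prob_cube k M \<longleftrightarrow> prob_space M \<and> sets M = sets (PiM {..<k} (\<lambda>_. borel))
     \<and> emeasure M (PiE {..<k} (\<lambda>_. {0..1})) = 1"

definition borel_prob_unit :: "real measure \<Rightarrow> bool" where
  "borel_prob_unit M \<longleftrightarrow> prob_space M \<and> sets M = sets borel \<and> emeasure M {0..1} = 1"

definition fourier_coeff :: "nat \<Rightarrow> (nat \<Rightarrow> real) measure \<Rightarrow> (nat \<Rightarrow> int) \<Rightarrow> complex" where
  "fourier_coeff k M \<xi> = (LINT x|M. cis (- 2 * pi * (\<Sum>j<k. real_of_int (\<xi> j) * x j)))"

definition fourier_coeff1 :: "real measure \<Rightarrow> int \<Rightarrow> complex" where
  "fourier_coeff1 M \<xi> = (LINT x|M. cis (- 2 * pi * real_of_int \<xi> * x))"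

definition int_box :: "nat \<Rightarrow> real \<Rightarrow> (nat \<Rightarrow> int) set" where
  "int_box k Q = PiE {..<k} (\<lambda>_. {i::int. \<bar>real_of_int i\<bar> \<le> Q})"

definition l1dim :: "nat \<Rightarrow> (nat \<Rightarrow> real) measure \<Rightarrow> real" where
  "l1dim k M = Sup {s. s \<ge> 0 \<and> (\<exists>C. \<forall>Q\<ge>1.
      (\<Sum>\<xi>\<in>int_box k Q. cmod (fourier_coeff k M \<xi>)) \<le> C * Q powr (real k - s))}"

definition l1dim1 :: "real measure \<Rightarrow> real" where
  "l1dim1 M = Sup {s. s \<ge> 0 \<and> (\<exists>C. \<forall>Q\<ge>1.
      (\<Sum>\<xi>\<in>{i::int. \<bar>real_of_int i\<bar> \<le> Q}. cmod (fourier_coeff1 M \<xi>)) \<le> C * Q powr (1 - s))}"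

definition W_set :: "nat \<Rightarrow> (nat \<Rightarrow> real) \<Rightarrow> (nat \<Rightarrow> real) \<Rightarrow> (nat \<Rightarrow> real) set" where
  "W_set k \<psi> y = {x \<in> PiE {..<k} (\<lambda>_. {0..<1}).
      infinite {n::nat. n \<ge> 1 \<and> (\<forall>j<k. dist_nint (real n * x j - y j) < \<psi> n)}}"

definition W_mult_set :: "nat \<Rightarrow> (nat \<Rightarrow> real) \<Rightarrow> (nat \<Rightarrow> real) \<Rightarrow> (nat \<Rightarrow> real) set" where
  "W_mult_set k \<psi> y = {x \<in> PiE {..<k} (\<lambda>_. {0..<1}).
      infinite {n::nat. n \<ge> 1 \<and> (\<Prod>j<k. dist_nint (real n * x j - y j)) < \<psi> n}}"

definition inhom_conv_khinchin :: "nat \<Rightarrow> (nat \<Rightarrow> real) measure \<Rightarrow> bool" where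
  "inhom_conv_khinchin k M \<longleftrightarrow> (\<forall>\<psi> :: nat \<Rightarrow> real.
      (\<forall>n. 0 \<le> \<psi> n \<and> \<psi> n < 1) \<and> antimono \<psi> \<and> summable (\<lambda>n. \<psi> n ^ k) \<longrightarrow>
      (\<forall>y. W_set k \<psi> y \<in> null_sets M))"

definition inhom_conv_gallagher :: "nat \<Rightarrow> (nat \<Rightarrow> real) measure \<Rightarrow> bool" where
  "inhom_conv_gallagher k M \<longleftrightarrow> (\<forall>\<psi> :: nat \<Rightarrow> real.
      (\<forall>n. 0 \<le> \<psi> n \<and> \<psi> n < 1) \<and> antimono \<psi> \<and> summable (\<lambda>n. \<psi> n * ln (real n) ^ (k - 1)) \<longrightarrow>
      (\<forall>y. W_mult_set k \<psi> y \<in> null_sets M))"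

end

theory Submission
  imports Defs
begin

text \<open>
  Dominate the indicator of \<parallel>t\<parallel> \<le> 1/(6L) by (4/L^2) |\<Sum>a<L. e(at)|^2, whose
  Fourier coefficients are at most 4/L and live on |\<xi>| < L. For a box of side lengths 1/L j, summing the
  measures of the events \<parallel>n x j - y j\<parallel> \<le> 1/(6 L j) over n in [N, 2N) gives a main term
  N / \<Prod>j. L j plus 1 / \<Prod>j. L j times the sum of |\<mu>^(n\<xi>)| over \<xi> \<noteq> 0. A nonzero
  frequency \<eta> = n\<xi> arises from at most N^o(1) pairs by the divisor bound, so the error is at most
  N^o(1) (N^k \<Prod>j. L j)^\<tau> with some \<tau> < 1/(k+1). This is O(N) as long as \<Prod>j. L j \<le>
  N^(1+\<epsilon>), which may be assumed after enlarging \<psi>. The main terms add up to the given convergent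
  series, and the Borel--Cantelli lemma applies. In the multiplicative case the region where the product of
  the distances is below 2^(-r) is covered by O(r^(k-1)) dyadic boxes of volume comparable to 2^(-r), and the
  product structure gives the spectral bound for boxes of unequal sides.
\<close>

subsection \<open>Counting divisors\<close>

text \<open>Follows from 1 + x \<le> exp x at x = e a ln 2, with K large enough that K e ln 2 \<ge>
  1. It serves twice: in the divisor bound, and to absorb powers of m into a geometric
  factor.\<close>

lemma linear_le_const_times_exp:
  fixes e :: real
  assumes "e > 0"
  obtains K where "K \<ge> 1" "\<And>a::nat. real (a + 1) \<le> K * 2 powr (e * real a)"
proof
  define K where "K = max 1 (1 / (e * ln 2))"
  show K1: "K \<ge> 1" by (simp add: K_def)
  have pos: "e * ln 2 > 0" using assms by simp
  have K2: "K * (e * ln 2) \<ge> 1"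
  proof -
    have "1 / (e * ln 2) * (e * ln 2) \<le> K * (e * ln 2)"
      by (rule mult_right_mono) (use pos in \<open>auto simp: K_def\<close>)
    then show ?thesis using assms by simp
  qed
  fix a :: nat
  have "real (a + 1) \<le> K + K * (e * ln 2) * real a"
    using K1 mult_right_mono[OF K2, of "real a"] by simp
  also have "\<dots> = K * (1 + e * real a * ln 2)" by (simp add: algebra_simps)
  also have "\<dots> \<le> K * exp (e * real a * ln 2)"
    using K1 exp_ge_add_one_self[of "e * real a * ln 2"] by (intro mult_left_mono) auto
  also have "exp (e * real a * ln 2) = 2 powr (e * real a)"
    by (simp add: powr_def)
  finally show "real (a + 1) \<le> K * 2 powr (e * real a)" .
qed

text \<open>The map (i, d) to p^i d is onto the divisors of p^a m. Only surjectivity is used, so p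
  may also divide m.\<close>

lemma card_divisors_prime_power_mult_le:
  fixes p a m :: nat
  assumes "prime p" "m > 0"
  shows "card {d. d dvd p ^ a * m} \<le> (a + 1) * card {d. d dvd m}"
proof -
  have "{d. d dvd p ^ a * m} \<subseteq> (\<lambda>(i, d). p ^ i * d) ` ({..a} \<times> {d. d dvd m})"
  proof
    fix d assume "d \<in> {d. d dvd p ^ a * m}"
    then obtain u v where uv: "d = u * v" "u dvd p ^ a" "v dvd m"
      by (auto elim: dvd_productE)
    then obtain i where "i \<le> a" "u = p ^ i"
      using divides_primepow_nat[OF \<open>prime p\<close>] by auto
    then show "d \<in> (\<lambda>(i, d). p ^ i * d) ` ({..a} \<times> {d. d dvd m})"
      using uv by force
  qed
  moreover have fin: "finite ({..a} \<times> {d. d dvd m})"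
    using assms by simp
  ultimately have "card {d. d dvd p ^ a * m} \<le> card ({..a} \<times> {d. d dvd m})"
    by (meson surj_card_le)
  then show ?thesis by (simp add: card_cartesian_product)
qed

text \<open>A prime power p^a contributes a + 1 \<le> p^(e a) once p^e \<ge> 2, so only the finitely many smaller primes
  cost a constant factor.\<close>

lemma card_divisors_le_powr:
  fixes e :: real
  assumes e: "e > 0"
  obtains C where "C \<ge> 0" "\<And>n::nat. n \<ge> 1 \<Longrightarrow> real (card {d. d dvd n})
      \<le> C * real n powr e"
proof -
  obtain K where K: "K \<ge> 1" "\<And>a::nat. real (a + 1) \<le> K * 2 powr (e * real a)"
    using linear_le_const_times_exp[OF e] by blast
  \<comment> \<open>From this threshold on p^e \<ge> 2, whence a + 1 \<le> 2^a \<le> p^(e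
    a).\<close>
  define P where "P = nat \<lceil>2 powr (1 / e)\<rceil>"
  have large: "real (a + 1) \<le> real (p ^ a) powr e" if "p \<ge> P" for p a :: nat
  proof -
    have "2 powr (1 / e) \<le> real p"
      using that unfolding P_def by linarith
    then have "(2 powr (1 / e)) powr e \<le> real p powr e"
      using e by (intro powr_mono2) auto
    then have p2: "2 \<le> real p powr e" using e by (simp add: powr_powr)
    have "a + 1 \<le> 2 ^ a"
      using less_exp[of a] by linarith
    then have "real (a + 1) \<le> 2 ^ a"
      by (metis of_nat_le_iff of_nat_numeral of_nat_power)
    also have "\<dots> \<le> (real p powr e) ^ a" using p2 by (intro power_mono) auto
    also have "\<dots> = real (p ^ a) powr e"
      by (cases "p = 0") (auto simp: powr_realpow[symmetric] powr_powr mult.commute power_0_left)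
    finally show ?thesis .
  qed
  have small: "real (a + 1) \<le> K * real (p ^ a) powr e" if "prime p" for p a :: nat
  proof -
    have p: "p \<ge> 2" using that by (rule prime_ge_2_nat)
    have "2 powr (e * real a) = (2 ^ a) powr e"
      by (simp add: powr_realpow[symmetric] powr_powr mult.commute)
    also have "\<dots> \<le> real (p ^ a) powr e"
      using p e by (intro powr_mono2) (auto intro!: power_mono)
    finally have "K * 2 powr (e * real a) \<le> K * real (p ^ a) powr e"
      using K by (intro mult_left_mono) auto
    then show ?thesis using K(2)[of a] by linarith
  qed
  \<comment> \<open>The induction strips a full prime power from n. A prime below P pays one factor
    K and leaves S; a larger prime pays nothing. Keeping S variable makes the total cost K^P at the
    end.\<close>
  have main: "real (card {d. d dvd n}) \<le> K ^ card S * real n powr e"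
    if "n \<ge> 1" "finite S" "\<And>p. prime p \<Longrightarrow> p dvd n \<Longrightarrow> p < P
        \<Longrightarrow> p \<in> S" for n :: nat and S
    using that
  proof (induction n arbitrary: S rule: less_induct)
    case (less n)
    show ?case
    proof (cases "n = 1")
      case True
      then show ?thesis using K by (simp add: one_le_power)
    next
      case False
      then obtain p where p: "prime p" "p dvd n" using prime_factor_nat by blast
      have "n \<noteq> 0" "\<not> is_unit p" using less.prems p by auto
      then obtain m where m: "n = p ^ multiplicity p n * m" "\<not> p dvd m"
        using multiplicity_decompose' by metis
      define a where "a = multiplicity p n"
      have nam: "n = p ^ a * m" using m a_def by simp
      have a1: "a \<ge> 1" using nam m(2) p(2) by (cases a) auto
      have m0: "m > 0" using nam \<open>n \<noteq> 0\<close> by (cases m) auto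
      have "p ^ a > 1" using a1 p(1) prime_gt_1_nat by (intro one_less_power) auto
      then have mn: "m < n" using nam m0 by simp
      have card: "real (card {d. d dvd n}) \<le> real (a + 1) * real (card {d. d dvd m})"
        using card_divisors_prime_power_mult_le[OF p(1) m0, of a] unfolding nam
        by (metis of_nat_le_iff of_nat_mult)
      have pw: "real n powr e = real (p ^ a) powr e * real m powr e"
        unfolding nam by (simp add: powr_mult)
      show ?thesis
      proof (cases "p < P")
        case True
        then have pS: "p \<in> S" using less.prems(3) p by auto
        have IH: "real (card {d. d dvd m}) \<le> K ^ card (S - {p}) * real m powr e"
          by (rule less.IH) (use mn m0 m(2) less.prems nam in \<open>auto intro: dvd_trans\<close>)
        have "real (card {d. d dvd n}) \<le> (K * real (p ^ a) powr e) * (K ^ card (S - {p}) * real m powr e)"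
          using card mult_mono[OF small[OF p(1), of a] IH] K by auto
        also have "\<dots> = K ^ Suc (card (S - {p})) * real n powr e"
          by (simp only: pw power_Suc mult_ac)
        also have "Suc (card (S - {p})) = card S"
          using pS less.prems(2) by (metis card.remove)
        finally show ?thesis .
      next
        case False
        have IH: "real (card {d. d dvd m}) \<le> K ^ card S * real m powr e"
          by (rule less.IH) (use mn m0 less.prems nam in \<open>auto intro: dvd_trans\<close>)
        have "real (card {d. d dvd n}) \<le> real (p ^ a) powr e * (K ^ card S * real m powr e)"
          using card mult_mono[OF large[of p a] IH] False by auto
        then show ?thesis by (simp only: pw mult_ac)
      qed
    qed
  qed
  show ?thesis
  proof (rule that)
    show "K ^ P \<ge> 0" using K by simp
    show "real (card {d. d dvd n}) \<le> K ^ P * real n powr e" if "n \<ge> 1" for n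
      using main[OF that, of "{..<P}"] by auto
  qed
qed

subsection \<open>A Fejer-type majorant\<close>

text \<open>This is 4/L times the Fejer kernel; the factor 4 compensates for the exponential sum
  being only known to be at least L/2 near the integers.\<close>

definition fejer_majorant :: "nat \<Rightarrow> real \<Rightarrow> real" where
  "fejer_majorant L t = 4 / (real L)\<^sup>2 * (cmod (\<Sum>a<L. cis (2 * pi * real a * t)))\<^sup>2"

text \<open>The count equals L - |\<xi>| for |\<xi>| < L and 0 otherwise. As a count of pairs it
  comes directly out of regrouping the squared modulus by differences.\<close>

definition fejer_coeff :: "nat \<Rightarrow> int \<Rightarrow> real" where
  "fejer_coeff L \<xi> = 4 / (real L)\<^sup>2 * real (card {p \<in> {..<L} \<times> {..<L}. int (snd p) - int (fst p) = \<xi>})"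

lemma fejer_majorant_nonneg: "fejer_majorant L t \<ge> 0"
  by (simp add: fejer_majorant_def)

text \<open>Within 1/(6L) of an integer all L phases are at most \<pi>/3 in absolute value modulo
  2\<pi>, so each cosine is at least 1/2 and the real part of the sum is at least L/2. For L = 1 the
  majorant is the constant 4.\<close>

lemma fejer_majorant_ge_1:
  assumes L: "L \<ge> 1" and t: "L = 1 \<or> dist_nint t \<le> 1 / (6 * real L)"
  shows "fejer_majorant L t \<ge> 1"
proof (cases "L = 1")
  case True
  then show ?thesis by (simp add: fejer_majorant_def)
next
  case False
  define u where "u = t - of_int (round t)"
  have u: "\<bar>u\<bar> \<le> 1 / (6 * real L)" using t False by (simp add: dist_nint_def u_def)
  have eq: "cis (2 * pi * real a * t) = cis (2 * pi * real a * u)" for a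
  proof -
    have "2 * pi * real a * t = 2 * pi * real a * u + 2 * pi * of_int (int a * round t)"
      by (simp add: u_def algebra_simps)
    then show ?thesis by (simp only: cis_mult[symmetric] cis_multiple_2pi Ints_of_int) simp
  qed
  have "1 / 2 \<le> cos (2 * pi * real a * u)" if "a < L" for a
  proof -
    have "real a * \<bar>u\<bar> \<le> real L * (1 / (6 * real L))"
      using that u by (intro mult_mono) auto
    also have "\<dots> = 1 / 6" using L by simp
    finally have "\<bar>2 * pi * real a * u\<bar> \<le> pi / 3"
      using pi_gt_zero by (simp add: abs_mult field_simps)
    then have "cos (pi / 3) \<le> cos \<bar>2 * pi * real a * u\<bar>"
      by (intro cos_monotone_0_pi_le) auto
    then show ?thesis by (simp add: cos_60)
  qed
  then have "(\<Sum>a<L. 1 / 2) \<le> (\<Sum>a<L. cos (2 * pi * real a * u))"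
    by (intro sum_mono) auto
  also have "\<dots> = Re (\<Sum>a<L. cis (2 * pi * real a * t))" by (simp add: eq)
  also have "\<dots> \<le> cmod (\<Sum>a<L. cis (2 * pi * real a * t))" by (rule complex_Re_le_cmod)
  finally have "(real L / 2)\<^sup>2 \<le> (cmod (\<Sum>a<L. cis (2 * pi * real a * t)))\<^sup>2"
    by (intro power_mono) auto
  then have "4 / (real L)\<^sup>2 * (real L / 2)\<^sup>2 \<le> fejer_majorant L t"
    unfolding fejer_majorant_def by (intro mult_left_mono) auto
  then show ?thesis using L by (simp add: power_divide)
qed

lemma fejer_coeff_nonneg: "fejer_coeff L \<xi> \<ge> 0"
  by (simp add: fejer_coeff_def)

text \<open>A pair with prescribed difference is determined by its first entry, so there are at most
  L of them.\<close>

lemma fejer_coeff_le: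
  assumes "L \<ge> 1"
  shows "fejer_coeff L \<xi> \<le> 4 / real L"
proof -
  have "inj_on fst {p \<in> {..<L} \<times> {..<L}. int (snd p) - int (fst p) = \<xi>}"
    by (auto simp: inj_on_def)
  then have "card {p \<in> {..<L} \<times> {..<L}. int (snd p) - int (fst p) = \<xi>}
      \<le> card {..<L}"
    by (rule card_inj_on_le) auto
  then have "fejer_coeff L \<xi> \<le> 4 / (real L)\<^sup>2 * real L"
    unfolding fejer_coeff_def by (intro mult_left_mono) auto
  then show ?thesis using assms by (simp add: power2_eq_square)
qed

text \<open>The squared modulus is the sum times its conjugate, grouped by the difference of the two
  indices. The endpoints \<plusminus>L carry coefficient 0; with L = 2^l the range then agrees with
  one side of \<open>freq_box\<close>.\<close>

lemma fejer_majorant_fourier: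
  "complex_of_real (fejer_majorant L t) =
     (\<Sum>\<xi>\<in>{- int L..int L}. of_real (fejer_coeff L \<xi>) * cis (- 2 * pi * of_int \<xi> * t))"
proof -
  let ?S = "\<lambda>\<xi>. {p \<in> {..<L} \<times> {..<L}. int (snd p) - int (fst p) = \<xi>}"
  have "(\<Sum>\<xi>\<in>{- int L..int L}. \<Sum>p\<in>?S \<xi>. cis (2 * pi * real (fst p) * t) * cnj (cis (2 * pi * real (snd p) * t)))
      = (\<Sum>p\<in>{..<L} \<times> {..<L}. cis (2 * pi * real (fst p) * t) * cnj (cis (2 * pi * real (snd p) * t)))"
    by (rule sum.group) auto
  also have "\<dots> = (\<Sum>a<L. cis (2 * pi * real a * t)) * cnj (\<Sum>a<L. cis (2 * pi * real a * t))"
    by (simp add: sum_product sum.cartesian_product case_prod_beta)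
  also have "\<dots> = of_real ((cmod (\<Sum>a<L. cis (2 * pi * real a * t)))\<^sup>2)"
    by (simp only: complex_norm_square)
  finally have eq: "of_real ((cmod (\<Sum>a<L. cis (2 * pi * real a * t)))\<^sup>2) =
    (\<Sum>\<xi>\<in>{- int L..int L}. \<Sum>p\<in>?S \<xi>. cis (2 * pi * real (fst p) * t) * cnj (cis (2 * pi * real (snd p) * t)))"
    by simp
  have summand: "cis (2 * pi * real (fst p) * t) * cnj (cis (2 * pi * real (snd p) * t))
      = cis (- 2 * pi * of_int \<xi> * t)" if "p \<in> ?S \<xi>" for p \<xi>
  proof -
    have \<xi>: "of_int \<xi> = real (snd p) - real (fst p)" using that by auto
    have "2 * pi * real (fst p) * t - 2 * pi * real (snd p) * t = - 2 * pi * of_int \<xi> * t"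
      unfolding \<xi> by (simp add: algebra_simps)
    then show ?thesis by (simp add: cis_cnj cis_mult)
  qed
  have "of_real ((cmod (\<Sum>a<L. cis (2 * pi * real a * t)))\<^sup>2) =
    (\<Sum>\<xi>\<in>{- int L..int L}. of_nat (card (?S \<xi>)) * cis (- 2 * pi * of_int \<xi> * t))"
    unfolding eq by (rule sum.cong[OF refl]) (simp only: summand sum_constant cong: sum.cong)
  then show ?thesis
    by (simp add: fejer_majorant_def fejer_coeff_def sum_distrib_left sum_divide_distrib mult.assoc)
qed

subsection \<open>Measures of coordinatewise approximation events\<close>

text \<open>The exponent depends on the coordinate because the multiplicative case requires boxes of
  unequal sides.\<close>

definition freq_box :: "nat \<Rightarrow> (nat \<Rightarrow> nat) \<Rightarrow> (nat \<Rightarrow> int) set" where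
  "freq_box k l = PiE {..<k} (\<lambda>j. {- (2 ^ l j)..2 ^ l j})"

text \<open>A coordinate with l j = 0 is deliberately left unconstrained: there the majorant with L = 1 is the constant
  4, so that the measure bound below holds for every l.\<close>

definition near_event :: "nat \<Rightarrow> (nat \<Rightarrow> real) \<Rightarrow> nat \<Rightarrow> (nat \<Rightarrow> nat) \<Rightarrow> (nat \<Rightarrow> real) set" where
  "near_event k y n l = {x \<in> PiE {..<k} (\<lambda>_. UNIV).
     \<forall>j<k. l j = 0 \<or> dist_nint (real n * x j - y j) \<le> 1 / 2 ^ (l j + 3)}"

lemma finite_freq_box [simp]: "finite (freq_box k l)"
  unfolding freq_box_def by (intro finite_PiE) auto

lemma borel_measurable_dist_nint [measurable]: "dist_nint \<in> borel_measurable borel"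
  unfolding dist_nint_def[abs_def] round_def by measurable

lemma measurable_dist_nint_component:
  assumes "j < k"
  shows "(\<lambda>x. dist_nint (real n * x j - y j)) \<in> borel_measurable (PiM {..<k} (\<lambda>_. borel))"
proof -
  have [measurable]: "(\<lambda>x. x j) \<in> borel_measurable (PiM {..<k} (\<lambda>_. borel :: real measure))"
    using assms by (intro measurable_component_singleton) auto
  show ?thesis by measurable
qed

lemma near_event_sets:
  assumes "sets M = sets (PiM {..<k} (\<lambda>_. borel))"
  shows "near_event k y n l \<in> sets M"
proof -
  have [measurable]: "(\<lambda>x. dist_nint (real n * x j - y j)) \<in> borel_measurable (PiM {..<k} (\<lambda>_. borel))"
    if "j \<in> {..<k}" for j
    using that measurable_dist_nint_component by auto
  have "{x \<in> space (PiM {..<k} (\<lambda>_. borel)).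
     \<forall>j\<in>{..<k}. l j = 0 \<or> dist_nint (real n * x j - y j) \<le> 1 / 2 ^ (l j + 3)}
     \<in> sets (PiM {..<k} (\<lambda>_. borel))"
    by measurable
  also have "{x \<in> space (PiM {..<k} (\<lambda>_. borel)).
     \<forall>j\<in>{..<k}. l j = 0 \<or> dist_nint (real n * x j - y j)
         \<le> 1 / 2 ^ (l j + 3)} = near_event k y n l"
    by (auto simp: near_event_def space_PiM)
  finally show ?thesis using assms by simp
qed

lemma prod_cis: "(\<Prod>j\<in>A. cis (f j)) = cis (\<Sum>j\<in>A. f j)"
  by (induction A rule: infinite_finite_induct) (auto simp: cis_mult)

lemma fourier_coeff_cong:
  assumes "\<And>j. j < k \<Longrightarrow> \<xi> j = \<xi>' j"
  shows "fourier_coeff k M \<xi> = fourier_coeff k M \<xi>'"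
proof -
  have "(\<Sum>j<k. real_of_int (\<xi> j) * x j)
      = (\<Sum>j<k. real_of_int (\<xi>' j) * x j)" for x :: "nat \<Rightarrow> real"
    using assms by (intro sum.cong) auto
  then show ?thesis by (simp only: fourier_coeff_def)
qed

lemma integrable_cis_linear:
  assumes "prob_space M" and M: "sets M = sets (PiM {..<k} (\<lambda>_. borel))"
  shows "integrable M (\<lambda>x. cis (- 2 * pi * (\<Sum>j<k. real_of_int (\<xi> j) * x j)))"
proof -
  interpret prob_space M by fact
  have comp: "(\<lambda>x. x j) \<in> borel_measurable M" if "j \<in> {..<k}" for j
    unfolding measurable_cong_sets[OF M refl]
    using that by (intro measurable_component_singleton) auto
  have [measurable]: "(\<lambda>x. \<Sum>j<k. real_of_int (\<xi> j) * x j) \<in> borel_measurable M"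
    by (intro borel_measurable_sum borel_measurable_times borel_measurable_const comp)
  have [measurable]: "cis \<in> borel_measurable borel"
    by (intro borel_measurable_continuous_onI continuous_intros)
  show ?thesis
    by (rule integrable_const_bound[of _ 1]) auto
qed

text \<open>The product of the one-dimensional majorants dominates the indicator and is a
  trigonometric polynomial in n x. Integrating it term by term produces the Fourier coefficients of
  M at n\<xi>, weighted by at most 4/2^(l j) per coordinate.\<close>

lemma measure_near_event_le:
  assumes "prob_space M" and M: "sets M = sets (PiM {..<k} (\<lambda>_. borel))"
  shows "measure M (near_event k y n l) \<le>
    4 ^ k / 2 ^ (\<Sum>j<k. l j) * (\<Sum>\<xi>\<in>freq_box k l. cmod (fourier_coeff k M (\<lambda>j. int n * \<xi> j)))"
proof -
  interpret prob_space M by fact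
  define L where "L j = (2::nat) ^ l j" for j
  have L1: "L j \<ge> 1" for j by (simp add: L_def)
  define F where "F x = (\<Prod>j<k. fejer_majorant (L j) (real n * x j - y j))" for x
  \<comment> \<open>The shift y enters only through these unimodular phases, so the final bound is
    uniform in y.\<close>
  define c where "c \<xi> = (\<Prod>j<k. complex_of_real (fejer_coeff (L j) (\<xi> j)) * cis (2 * pi * of_int (\<xi> j) * y j))" for \<xi>
  define e where "e \<xi> x = cis (- 2 * pi * (\<Sum>j<k. real_of_int (int n * \<xi> j) * x j))" for \<xi> and x :: "nat \<Rightarrow> real"
  have F_eq: "complex_of_real (F x) = (\<Sum>\<xi>\<in>freq_box k l. c \<xi> * e \<xi> x)" for x
  proof -
    have "complex_of_real (F x) = (\<Prod>j<k. \<Sum>\<xi>\<in>{- int (L j)..int (L j)}.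
        of_real (fejer_coeff (L j) \<xi>) * cis (- 2 * pi * of_int \<xi> * (real n * x j - y j)))"
      unfolding F_def of_real_prod fejer_majorant_fourier ..
    also have "\<dots> = (\<Sum>\<xi>\<in>freq_box k l. \<Prod>j<k.
        of_real (fejer_coeff (L j) (\<xi> j)) * cis (- 2 * pi * of_int (\<xi> j) * (real n * x j - y j)))"
      by (subst prod_sum_PiE) (auto simp: freq_box_def L_def)
    also have "\<dots> = (\<Sum>\<xi>\<in>freq_box k l. c \<xi> * e \<xi> x)"
    proof (rule sum.cong[OF refl])
      fix \<xi>
      have "of_real (fejer_coeff (L j) (\<xi> j)) * cis (- 2 * pi * of_int (\<xi> j) * (real n * x j - y j))
         = (of_real (fejer_coeff (L j) (\<xi> j)) * cis (2 * pi * of_int (\<xi> j) * y j))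
           * cis (- 2 * pi * (real_of_int (int n * \<xi> j) * x j))" for j
        by (simp add: cis_mult mult.assoc) (simp add: algebra_simps)
      then show "(\<Prod>j<k. of_real (fejer_coeff (L j) (\<xi> j)) * cis (- 2 * pi * of_int (\<xi> j) * (real n * x j - y j)))
         = c \<xi> * e \<xi> x"
        by (simp only: c_def e_def prod.distrib prod_cis sum_distrib_left)
    qed
    finally show ?thesis .
  qed
  have int_e: "integrable M (e \<xi>)" for \<xi>
    unfolding e_def[abs_def] by (rule integrable_cis_linear[OF assms])
  have int_cF: "integrable M (\<lambda>x. complex_of_real (F x))"
    unfolding F_eq using int_e by (intro Bochner_Integration.integrable_sum) auto
  then have int_F: "integrable M F"
    using integrable_Re by fastforce
  have cmod_c: "cmod (c \<xi>) \<le> 4 ^ k / 2 ^ (\<Sum>j<k. l j)" for \<xi>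
  proof -
    have "cmod (c \<xi>) = (\<Prod>j<k. fejer_coeff (L j) (\<xi> j))"
      unfolding c_def by (simp add: norm_mult prod_norm[symmetric] fejer_coeff_nonneg)
    also have "\<dots> \<le> (\<Prod>j<k. 4 / real (L j))"
      using L1 by (intro prod_mono) (auto simp: fejer_coeff_nonneg intro: fejer_coeff_le)
    also have "\<dots> = 4 ^ k / 2 ^ (\<Sum>j<k. l j)"
      by (simp add: prod_dividef L_def power_sum)
    finally show ?thesis .
  qed
  have F_ge: "indicator (near_event k y n l) x \<le> F x" for x
  proof (cases "x \<in> near_event k y n l")
    case True
    have "1 \<le> fejer_majorant (L j) (real n * x j - y j)" if "j < k" for j
    proof (rule fejer_majorant_ge_1[OF L1])
      have "l j = 0 \<or> dist_nint (real n * x j - y j) \<le> 1 / 2 ^ (l j + 3)"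
        using True that by (auto simp: near_event_def)
      \<comment> \<open>The offset 3 in \<open>near_event\<close> is there because 2^3 \<ge>
        6.\<close>
      moreover have "1 / 2 ^ (l j + 3) \<le> 1 / (6 * real (L j))"
        by (auto simp: L_def power_add intro!: divide_left_mono)
      ultimately show "L j = 1 \<or> dist_nint (real n * x j - y j) \<le> 1 / (6 * real (L j))"
        by (auto simp: L_def)
    qed
    then have "F x \<ge> 1" unfolding F_def by (intro prod_ge_1) auto
    then show ?thesis using True by simp
  next
    case False
    then show ?thesis by (auto simp: F_def intro!: prod_nonneg fejer_majorant_nonneg)
  qed
  have "measure M (near_event k y n l) = (\<integral>x. indicator (near_event k y n l) x \<partial>M)"
    using near_event_sets[OF M] by simp
  also have "\<dots> \<le> (\<integral>x. F x \<partial>M)"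
    using near_event_sets[OF M] F_ge int_F by (intro integral_mono) (auto simp: emeasure_eq_measure)
  also have "\<dots> \<le> cmod (complex_of_real (\<integral>x. F x \<partial>M))" by simp
  also have "complex_of_real (\<integral>x. F x \<partial>M)
      = (\<integral>x. complex_of_real (F x) \<partial>M)"
    by simp
  also have "\<dots> = (\<Sum>\<xi>\<in>freq_box k l. c \<xi> * (\<integral>x. e \<xi> x \<partial>M))"
    unfolding F_eq using int_e by (subst Bochner_Integration.integral_sum) auto
  also have "cmod \<dots> \<le> (\<Sum>\<xi>\<in>freq_box k l. cmod (c \<xi>) * cmod (\<integral>x. e \<xi> x \<partial>M))"
    by (rule order_trans[OF norm_sum]) (simp add: norm_mult)
  also have "\<dots> \<le> (\<Sum>\<xi>\<in>freq_box k l. 4 ^ k / 2 ^ (\<Sum>j<k. l j) * cmod (fourier_coeff k M (\<lambda>j. int n * \<xi> j)))"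
    unfolding e_def fourier_coeff_def by (intro sum_mono mult_right_mono cmod_c) auto
  finally show ?thesis by (simp add: sum_distrib_left)
qed

text \<open>If \<eta> = n\<xi> with \<xi> nonzero, some coordinate \<eta> j is nonzero and n divides
  it, while n and \<eta> determine \<xi>. Hence \<eta> has at most as many representations as
  |\<eta> j| has divisors. Since n < 2^(m+1), all these \<eta> lie in the box with every exponent
  raised by m + 1.\<close>

lemma sum_dilates_le:
  fixes g :: "(nat \<Rightarrow> int) \<Rightarrow> real" and D :: real
  assumes g: "\<And>\<eta>. g \<eta> \<ge> 0"
    and D: "\<And>a::nat. 1 \<le> a \<Longrightarrow> a
        \<le> 2 ^ (m + 1 + (\<Sum>j<k. l j)) \<Longrightarrow> real (card {d. d dvd a}) \<le> D"
  shows "(\<Sum>n\<in>{2^m..<2^(m+1)}. \<Sum>\<xi>\<in>freq_box k l - {\<lambda>j\<in>{..<k}. 0}. g (\<lambda>j\<in>{..<k}. int n * \<xi> j))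
     \<le> D * (\<Sum>\<eta>\<in>freq_box k (\<lambda>j. l j + (m + 1)). g \<eta>)"
proof -
  define B where "B = freq_box k l - {\<lambda>j\<in>{..<k}. 0}"
  define P where "P = {2^m..<(2::nat)^(m+1)} \<times> B"
  define h where "h = (\<lambda>(n::nat, \<xi>::nat \<Rightarrow> int). \<lambda>j\<in>{..<k}. int n * \<xi> j)"
  have finP: "finite P" by (simp add: P_def B_def)
  have box: "h ` P \<subseteq> freq_box k (\<lambda>j. l j + (m + 1))"
  proof
    fix \<eta> assume "\<eta> \<in> h ` P"
    then obtain n \<xi> where n: "n < 2 ^ (m + 1)" and \<xi>: "\<xi> \<in> freq_box k l"
        and \<eta>: "\<eta> = (\<lambda>j\<in>{..<k}. int n * \<xi> j)"
      unfolding P_def B_def h_def by fastforce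
    have "\<bar>int n * \<xi> j\<bar> \<le> 2 ^ (l j + (m + 1))" if "j < k" for j
    proof -
      have "\<bar>\<xi> j\<bar> \<le> 2 ^ l j" using \<xi> that
          by (simp add: freq_box_def PiE_iff abs_le_iff minus_le_iff)
      moreover have "int n \<le> 2 ^ (m + 1)" using n
        by (metis less_imp_le of_nat_le_iff of_nat_numeral of_nat_power)
      ultimately have "int n * \<bar>\<xi> j\<bar> \<le> 2 ^ (m + 1) * 2 ^ l j"
          by (intro mult_mono) auto
      then show ?thesis by (simp add: abs_mult power_add mult_ac)
    qed
    then show "\<eta> \<in> freq_box k (\<lambda>j. l j + (m + 1))"
      unfolding \<eta> freq_box_def by (simp add: PiE_iff abs_le_iff minus_le_iff)
  qed
  have fibre: "real (card {p \<in> P. h p = \<eta>}) \<le> D" if "\<eta> \<in> h ` P" for \<eta>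
  proof -
    obtain n \<xi> where n: "n \<ge> 2^m" and \<xi>: "\<xi> \<in> B" and \<eta>: "\<eta>
        = (\<lambda>j\<in>{..<k}. int n * \<xi> j)"
      using \<open>\<eta> \<in> h ` P\<close> by (auto simp: P_def h_def)
    have npos: "n > 0" if "n \<ge> 2^m" for n :: nat using that
      by (metis gr0I less_le_trans power_not_zero zero_neq_numeral le_zero_eq)
    have "\<exists>j<k. \<xi> j \<noteq> 0"
    proof (rule ccontr)
      assume "\<not> ?thesis"
      then have "\<xi> = (\<lambda>j\<in>{..<k}. 0)"
        using \<xi> by (intro ext) (auto simp: B_def freq_box_def PiE_iff extensional_def)
      then show False using \<xi> by (simp add: B_def)
    qed
    \<comment> \<open>The chosen representation serves only to locate a nonzero coordinate of
      \<eta>; that coordinate then controls every other representation.\<close>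
    then obtain j where j: "j < k" "\<xi> j \<noteq> 0" by auto
    define a where "a = nat \<bar>\<eta> j\<bar>"
    have "\<eta> j \<noteq> 0" using j npos[OF n] by (simp add: \<eta>)
    then have a1: "a \<ge> 1" by (simp add: a_def)
    have "\<eta> \<in> freq_box k (\<lambda>j. l j + (m + 1))" using box that by auto
    then have "\<bar>\<eta> j\<bar> \<le> 2 ^ (l j + (m + 1))"
      using j by (simp add: freq_box_def PiE_iff abs_le_iff minus_le_iff)
    also have "\<dots> \<le> 2 ^ (m + 1 + (\<Sum>j<k. l j))"
      using j member_le_sum[of j "{..<k}" l] by (intro power_increasing) auto
    finally have "int a \<le> int (2 ^ (m + 1 + (\<Sum>j<k. l j)))" by (simp add: a_def)
    then have a2: "a \<le> 2 ^ (m + 1 + (\<Sum>j<k. l j))" by (simp only: of_nat_le_iff)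
    have "inj_on fst {p \<in> P. h p = \<eta>}"
    proof (rule inj_onI)
      fix p p' assume p: "p \<in> {p \<in> P. h p = \<eta>}" "p' \<in> {p \<in> P. h p
          = \<eta>}" "fst p = fst p'"
      obtain n \<xi> \<xi>' where pp: "p = (n, \<xi>)" "p' = (n, \<xi>')" using p(3)
          by (metis prod.collapse)
      then have *: "(n, \<xi>) \<in> P" "(n, \<xi>') \<in> P" "h (n, \<xi>) = \<eta>" "h (n, \<xi>')
          = \<eta>"
        using p by auto
      then have eq: "(\<lambda>j\<in>{..<k}. int n * \<xi> j)
          = (\<lambda>j\<in>{..<k}. int n * \<xi>' j)" by (simp add: h_def)
      have n0: "n > 0" using * npos by (auto simp: P_def)
      have "\<xi> j = \<xi>' j" if "j \<in> {..<k}" for j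
        using fun_cong[OF eq, of j] that n0 by auto
      moreover have "\<xi> \<in> extensional {..<k}" "\<xi>' \<in> extensional {..<k}"
        using * by (auto simp: P_def B_def freq_box_def PiE_iff)
      ultimately have "\<xi> = \<xi>'" by (meson extensionalityI)
      then show "p = p'" by (simp add: pp)
    qed
    moreover have "fst ` {p \<in> P. h p = \<eta>} \<subseteq> {d. d dvd a}"
    proof (intro image_subsetI CollectI)
      fix p assume "p \<in> {p \<in> P. h p = \<eta>}"
      moreover obtain n' \<xi>' where p: "p = (n', \<xi>')" by fastforce
      ultimately have "\<eta> = h (n', \<xi>')" by simp
      then have "\<eta> j = int n' * \<xi>' j" using j by (simp add: h_def)
      then have "int n' dvd \<bar>\<eta> j\<bar>" by simp
      then show "fst p dvd a" by (simp add: a_def p flip: int_dvd_int_iff)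
    qed
    moreover have "finite {d. d dvd a}" using a1 by simp
    ultimately have "card {p \<in> P. h p = \<eta>} \<le> card {d. d dvd a}"
      by (rule card_inj_on_le)
    then show ?thesis using D[OF a1 a2] by linarith
  qed
  have "D \<ge> real (card {d::nat. d dvd 1})" by (intro D) auto
  then have D0: "D \<ge> 0" by linarith
  have "(\<Sum>n\<in>{2^m..<2^(m+1)}. \<Sum>\<xi>\<in>B. g (\<lambda>j\<in>{..<k}. int n * \<xi> j))
      = (\<Sum>p\<in>P. g (h p))"
    unfolding P_def by (simp add: sum.cartesian_product h_def case_prod_beta)
  also have "\<dots> = (\<Sum>\<eta>\<in>h ` P. \<Sum>p | p \<in> P \<and> h p = \<eta>. g (h p))"
    by (rule sum.image_gen[OF finP])
  also have "\<dots> = (\<Sum>\<eta>\<in>h ` P. real (card {p \<in> P. h p = \<eta>}) * g \<eta>)"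
    by (intro sum.cong refl) simp
  also have "\<dots> \<le> (\<Sum>\<eta>\<in>h ` P. D * g \<eta>)"
    by (intro sum_mono mult_right_mono fibre g)
  also have "\<dots> \<le> (\<Sum>\<eta>\<in>freq_box k (\<lambda>j. l j + (m + 1)). D * g \<eta>)"
    using box g D0 by (intro sum_mono2) auto
  finally show ?thesis by (simp add: sum_distrib_left B_def)
qed

subsection \<open>Dyadic blocks and the Borel--Cantelli lemma\<close>

text \<open>Frequency zero contributes 1 for each n, hence 2^m in total. The others contribute the
  divisor bound times the spectral sum over the enlarged box, and this is O(2^m) too. Stating the
  spectral bound as a premise on the box lets cubes and product measures share the argument;
  \<epsilon> and K do not depend on m, l or y.\<close>

lemma block_sum_near_event_le:
  assumes "prob_space M" and M: "sets M = sets (PiM {..<k} (\<lambda>_. borel))"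
    and \<tau>: "\<tau> \<ge> 0" "\<tau> * (real k + 1) < 1" and C: "C \<ge> 0"
  obtains \<epsilon> K :: real where "\<epsilon> > 0" "\<epsilon> \<le> 1" "K \<ge> 0"
    "\<And>m l y. \<lbrakk>real (\<Sum>j<k. l j) \<le> (1 + \<epsilon>) * real m;
       (\<Sum>\<xi>\<in>freq_box k (\<lambda>j. l j + (m + 1)). cmod (fourier_coeff k M \<xi>))
         \<le> C * 2 powr (\<tau> * real (\<Sum>j<k. l j + (m + 1)))\<rbrakk>
     \<Longrightarrow> (\<Sum>n\<in>{2^m..<2^(m+1)}. measure M (near_event k y n l))
         \<le> K * (2 ^ m / 2 ^ (\<Sum>j<k. l j))"
proof -
  interpret prob_space M by fact
  \<comment> \<open>The gap 1 - \<tau>(k+1) equals 2\<epsilon>: one \<epsilon> pays for the divisor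
    bound, the other for letting the exponents l j add up to (1 + \<epsilon>) m rather than
    m.\<close>
  define \<epsilon> where "\<epsilon> = (1 - \<tau> * (real k + 1)) / 2"
  have \<epsilon>: "\<epsilon> > 0" "\<epsilon> \<le> 1"
      using \<tau>(2) mult_nonneg_nonneg[OF \<tau>(1), of "real k + 1"] unfolding \<epsilon>_def
          by simp_all
  \<comment> \<open>The integers whose divisors are counted are at most 2^(m+1+R) with R \<le> 2m,
    so exponent \<epsilon>/3 costs only a constant times 2^(\<epsilon> m).\<close>
  obtain Cd where Cd: "Cd \<ge> 0" "\<And>n::nat. n \<ge> 1
      \<Longrightarrow> real (card {d. d dvd n}) \<le> Cd * real n powr (\<epsilon> / 3)"
    using card_divisors_le_powr[of "\<epsilon> / 3"] \<epsilon> by auto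
  define K where "K = 4 ^ k * (1 + 4 * Cd * C)"
  show ?thesis
  proof (rule that[OF \<epsilon>])
    show "K \<ge> 0" using Cd C by (simp add: K_def)
    fix m :: nat and l :: "nat \<Rightarrow> nat" and y :: "nat \<Rightarrow> real"
    define R where "R = (\<Sum>j<k. l j)"
    assume "real (\<Sum>j<k. l j) \<le> (1 + \<epsilon>) * real m"
    then have R: "real R \<le> (1 + \<epsilon>) * real m" by (simp add: R_def)
    assume spec: "(\<Sum>\<xi>\<in>freq_box k (\<lambda>j. l j + (m + 1)). cmod (fourier_coeff k M \<xi>))
         \<le> C * 2 powr (\<tau> * real (\<Sum>j<k. l j + (m + 1)))"
    define D where "D = 2 * Cd * 2 powr (\<epsilon> * real m)"
    have \<epsilon>m: "\<epsilon> * real m \<le> real m" using \<epsilon>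
        by (simp add: mult_left_le_one_le)
    have D: "real (card {d. d dvd a}) \<le> D" if "1 \<le> a" "a
        \<le> 2 ^ (m + 1 + (\<Sum>j<k. l j))" for a :: nat
    proof -
      have "real a \<le> 2 ^ (m + 1 + R)"
        using that(2) unfolding R_def by (metis of_nat_le_iff of_nat_numeral of_nat_power)
      then have "real a powr (\<epsilon> / 3) \<le> (2 ^ (m + 1 + R)) powr (\<epsilon> / 3)"
        using \<epsilon> by (intro powr_mono2) auto
      also have "\<dots> = 2 powr (\<epsilon> / 3 * real (m + 1 + R))"
        by (simp only: powr_realpow[symmetric] powr_powr zero_less_numeral mult.commute)
      also have "\<dots> \<le> 2 powr (\<epsilon> / 3 * (3 * real m + 3))"
        using R \<epsilon> \<epsilon>m by (intro powr_mono mult_left_mono) (auto simp: algebra_simps)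
      also have "\<dots> \<le> 2 powr (1 + \<epsilon> * real m)"
        using \<epsilon> by (intro powr_mono) (auto simp: algebra_simps)
      also have "\<dots> = 2 * 2 powr (\<epsilon> * real m)" by (simp add: powr_add)
      finally show ?thesis
        using Cd(2)[OF that(1)] mult_left_mono[of "real a powr (\<epsilon>/3)" "2 * 2 powr (\<epsilon> * real m)" Cd] Cd(1)
        by (simp add: D_def)
    qed
    have D0: "D \<ge> 0" using Cd by (simp add: D_def)
    let ?g = "\<lambda>\<xi>. cmod (fourier_coeff k M \<xi>)"
    let ?z = "\<lambda>j\<in>{..<k}. 0 :: int"
    have restr: "?g (\<lambda>j. int n * \<xi> j)
        = ?g (\<lambda>j\<in>{..<k}. int n * \<xi> j)" for n \<xi>
      by (rule arg_cong[where f = cmod], rule fourier_coeff_cong) simp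
    have zmem: "?z \<in> freq_box k l" by (auto simp: freq_box_def)
    have z1: "?g (\<lambda>j\<in>{..<k}. int n * ?z j) = 1" for n
    proof -
      have "fourier_coeff k M (\<lambda>j\<in>{..<k}. int n * ?z j)
          = fourier_coeff k M (\<lambda>_. 0)"
        by (rule fourier_coeff_cong) simp
      also have "\<dots> = 1" by (simp add: fourier_coeff_def prob_space)
      finally show ?thesis by simp
    qed
    have "\<tau> * real (\<Sum>j<k. l j + (m + 1)) = \<tau> * (real R + real k * (real m + 1))"
      by (simp add: R_def sum.distrib algebra_simps)
    also have "\<dots> \<le> \<tau> * ((1 + \<epsilon>) * real m + real k * (real m + 1))"
      using R \<tau> by (intro mult_left_mono add_right_mono) auto
    also have "\<dots> = (\<tau> * (real k + 1)) * real m + \<tau> * \<epsilon> * real m + \<tau> * real k"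
      by (simp add: algebra_simps)
    also have "\<dots> \<le> (1 - 2 * \<epsilon>) * real m + \<epsilon> * real m + 1"
    proof -
      have "\<tau> * real k \<le> 1" "\<tau> \<le> 1"
        using \<tau> mult_nonneg_nonneg[of \<tau> "real k"] unfolding distrib_left by linarith+
      moreover have "\<tau> * \<epsilon> * real m \<le> \<epsilon> * real m"
        using \<open>\<tau> \<le> 1\<close> \<epsilon> \<tau>
            by (intro mult_right_mono) (auto simp: mult_left_le_one_le)
      moreover have "\<tau> * (real k + 1) = 1 - 2 * \<epsilon>"
          by (simp add: \<epsilon>_def field_simps)
      ultimately show ?thesis by simp
    qed
    finally have expo: "\<tau> * real (\<Sum>j<k. l j + (m + 1))
        \<le> 1 + (real m - \<epsilon> * real m)"
      by (simp add: algebra_simps)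
    have spec': "(\<Sum>\<xi>\<in>freq_box k (\<lambda>j. l j + (m + 1)). ?g \<xi>)
        \<le> C * (2 * 2 powr (real m - \<epsilon> * real m))"
    proof -
      have "2 powr (\<tau> * real (\<Sum>j<k. l j + (m + 1)))
          \<le> (2::real) powr (1 + (real m - \<epsilon> * real m))"
        using expo by (intro powr_mono) auto
      also have "\<dots> = 2 * 2 powr (real m - \<epsilon> * real m)" by (simp only: powr_add) simp
      finally show ?thesis using spec mult_left_mono[OF _ C] by (meson order_trans)
    qed
    have "(\<Sum>n\<in>{2^m..<2^(m+1)}. \<Sum>\<xi>\<in>freq_box k l. ?g (\<lambda>j\<in>{..<k}. int n * \<xi> j))
        = (\<Sum>n\<in>{2^m..<2^(m+1)}. 1 + (\<Sum>\<xi>\<in>freq_box k l - {?z}. ?g (\<lambda>j\<in>{..<k}. int n * \<xi> j)))"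
      by (intro sum.cong refl, subst sum.remove[OF _ zmem]) (simp_all only: finite_freq_box z1)
    also have "\<dots> = 2 ^ m + (\<Sum>n\<in>{2^m..<2^(m+1)}. \<Sum>\<xi>\<in>freq_box k l - {?z}. ?g (\<lambda>j\<in>{..<k}. int n * \<xi> j))"
      by (simp add: sum.distrib)
    also have "\<dots> \<le> 2 ^ m + D * (\<Sum>\<eta>\<in>freq_box k (\<lambda>j. l j + (m + 1)). ?g \<eta>)"
      using D by (intro add_left_mono sum_dilates_le) auto
    also have "\<dots> \<le> 2 ^ m + D * (C * (2 * 2 powr (real m - \<epsilon> * real m)))"
      using D0 spec' by (intro add_left_mono mult_left_mono) auto
    also have "D * (C * (2 * 2 powr (real m - \<epsilon> * real m)))
        = 4 * Cd * C * (2 powr (\<epsilon> * real m) * 2 powr (real m - \<epsilon> * real m))"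
      by (simp add: D_def)
    also have "2 powr (\<epsilon> * real m) * 2 powr (real m - \<epsilon> * real m) = (2::real) ^ m"
      by (simp add: powr_add[symmetric] powr_realpow)
    also have "2 ^ m + 4 * Cd * C * 2 ^ m = (1 + 4 * Cd * C) * 2 ^ m" by (simp add: algebra_simps)
    finally have total: "(\<Sum>n\<in>{2^m..<2^(m+1)}. \<Sum>\<xi>\<in>freq_box k l. ?g (\<lambda>j\<in>{..<k}. int n * \<xi> j))
        \<le> (1 + 4 * Cd * C) * 2 ^ m" .
    have "(\<Sum>n\<in>{2^m..<2^(m+1)}. measure M (near_event k y n l))
        \<le> (\<Sum>n\<in>{2^m..<2^(m+1)}. 4 ^ k / 2 ^ R * (\<Sum>\<xi>\<in>freq_box k l. ?g (\<lambda>j\<in>{..<k}. int n * \<xi> j)))"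
      unfolding R_def restr[symmetric] by (intro sum_mono measure_near_event_le assms)
    also have "\<dots> = 4 ^ k / 2 ^ R * (\<Sum>n\<in>{2^m..<2^(m+1)}. \<Sum>\<xi>\<in>freq_box k l. ?g (\<lambda>j\<in>{..<k}. int n * \<xi> j))"
      by (simp only: sum_distrib_left)
    also have "\<dots> \<le> 4 ^ k / 2 ^ R * ((1 + 4 * Cd * C) * 2 ^ m)"
      using total by (intro mult_left_mono) auto
    also have "\<dots> = K * (2 ^ m / 2 ^ R)" by (simp add: K_def)
    finally show "(\<Sum>n\<in>{2^m..<2^(m+1)}. measure M (near_event k y n l))
        \<le> K * (2 ^ m / 2 ^ (\<Sum>j<k. l j))"
      by (simp add: R_def)
  qed
qed

lemma sum_dyadic_blocks:
  fixes f :: "nat \<Rightarrow> 'a :: comm_monoid_add"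
  shows "(\<Sum>m<p. \<Sum>n\<in>{2^m..<2^(m+1)}. f n) = (\<Sum>n\<in>{1..<2^p}. f n)"
  by (induction p) (simp_all add: sum.atLeastLessThan_concat)

lemma summable_dyadic_blocks_iff:
  fixes f :: "nat \<Rightarrow> real"
  assumes f: "\<And>n. f n \<ge> 0"
  shows "summable (\<lambda>m. \<Sum>n\<in>{2^m..<2^(m+1)}. f n) \<longleftrightarrow> summable f"
proof
  assume *: "summable (\<lambda>m. \<Sum>n\<in>{2^m..<2^(m+1)}. f n)"
  show "summable f"
  proof (rule summableI_nonneg_bounded[OF f])
    fix n
    \<comment> \<open>The dyadic blocks start at 1, so the term at 0 is carried separately.\<close>
    have "(\<Sum>i<n. f i) \<le> (\<Sum>i\<in>insert 0 {1..<2^n}. f i)"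
      using f less_exp[of n] by (intro sum_mono2) (auto simp: Suc_le_eq dest: less_trans[of _ n "2 ^ n"])
    also have "\<dots> = f 0 + (\<Sum>m<n. \<Sum>i\<in>{2^m..<2^(m+1)}. f i)"
      unfolding sum_dyadic_blocks by simp
    also have "\<dots> \<le> f 0 + (\<Sum>m. \<Sum>i\<in>{2^m..<2^(m+1)}. f i)"
      using f by (intro add_left_mono sum_le_suminf[OF *]) (auto intro: sum_nonneg)
    finally show "(\<Sum>i<n. f i) \<le> f 0 + (\<Sum>m. \<Sum>i\<in>{2^m..<2^(m+1)}. f i)" .
  qed
next
  assume *: "summable f"
  show "summable (\<lambda>m. \<Sum>n\<in>{2^m..<2^(m+1)}. f n)"
  proof (rule summableI_nonneg_bounded)
    show "0 \<le> (\<Sum>n\<in>{2^m..<2^(m+1)}. f n)" for m using f by (intro sum_nonneg)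
    show "(\<Sum>m<p. \<Sum>n\<in>{2^m..<2^(m+1)}. f n) \<le> suminf f" for p
      unfolding sum_dyadic_blocks using f by (intro sum_le_suminf[OF *]) auto
  qed
qed

text \<open>Common end of both cases. The union bound over \<open>LL m\<close>, with the sums over n
  and l interchanged, reduces everything to the block estimate for one fixed l; Borel--Cantelli then
  applies.\<close>

lemma limsup_null_if_dyadic_cover:
  assumes "prob_space M" and M: "sets M = sets (PiM {..<k} (\<lambda>_. borel))"
    and A: "\<And>n. A n \<in> sets M"
    and fin: "\<And>m. finite (LL m)"
    and cover: "\<And>m n. 2 ^ m \<le> n \<Longrightarrow> n < 2 ^ (m + 1)
        \<Longrightarrow> A n \<subseteq> (\<Union>l\<in>LL m. near_event k y n l)"
    and block: "\<And>m l. l \<in> LL m \<Longrightarrow> (\<Sum>n\<in>{2^m..<2^(m+1)}. measure M (near_event k y n l)) \<le> b m"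
    and summ: "summable (\<lambda>m. real (card (LL m)) * b m)"
  shows "limsup A \<in> null_sets M"
proof -
  interpret prob_space M by fact
  have "summable (\<lambda>m. \<Sum>n\<in>{2^m..<2^(m+1)}. measure M (A n))"
  proof (rule summable_comparison_test[OF _ summ], intro exI allI impI)
    fix m
    have "(\<Sum>n\<in>{2^m..<2^(m+1)}. measure M (A n))
        \<le> (\<Sum>n\<in>{2^m..<2^(m+1)}. \<Sum>l\<in>LL m. measure M (near_event k y n l))"
    proof (rule sum_mono)
      fix n assume n: "n \<in> {2^m..<(2::nat)^(m+1)}"
      have "measure M (A n) \<le> measure M (\<Union>l\<in>LL m. near_event k y n l)"
        using n cover fin near_event_sets[OF M] by (intro finite_measure_mono) auto
      also have "\<dots> \<le> (\<Sum>l\<in>LL m. measure M (near_event k y n l))"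
        using fin near_event_sets[OF M] by (intro finite_measure_subadditive_finite) auto
      finally show "measure M (A n) \<le> (\<Sum>l\<in>LL m. measure M (near_event k y n l))" .
    qed
    also have "\<dots> = (\<Sum>l\<in>LL m. \<Sum>n\<in>{2^m..<2^(m+1)}. measure M (near_event k y n l))"
      by (rule sum.swap)
    also have "\<dots> \<le> (\<Sum>l\<in>LL m. b m)" by (intro sum_mono block)
    finally show "norm (\<Sum>n\<in>{2^m..<2^(m+1)}. measure M (A n))
        \<le> real (card (LL m)) * b m"
      by (simp add: sum_nonneg)
  qed
  then have "summable (\<lambda>n. measure M (A n))"
    by (subst (asm) summable_dyadic_blocks_iff) auto
  then show ?thesis
    using A by (intro borel_cantelli_limsup1) (auto simp: emeasure_eq_measure)
qed

lemma null_sets_infinitely_often: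
  fixes k :: nat
  assumes M: "sets M = sets (PiM {..<k} (\<lambda>_. borel))"
    and A: "limsup A \<in> null_sets M"
    and A_eq: "\<And>n. A n = {x \<in> space M. n \<ge> 1 \<and> Q n x}"
  shows "{x \<in> PiE {..<k} (\<lambda>_. {0..<1::real}). infinite {n::nat. n \<ge> 1 \<and> Q n x}} \<in> null_sets M"
proof -
  have "space M = PiE {..<k} (\<lambda>_. UNIV)"
    using sets_eq_imp_space_eq[OF M] by (simp add: space_PiM)
  then have "{x \<in> PiE {..<k} (\<lambda>_. {0..<1}). infinite {n::nat. n \<ge> 1 \<and> Q n x}}
      = limsup A \<inter> PiE {..<k} (\<lambda>_. {0..<1})"
    by (auto simp: limsup_INF_SUP A_eq infinite_nat_iff_unbounded_le PiE_iff extensional_def)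
  moreover have "PiE {..<k} (\<lambda>_. {0..<1::real}) \<in> sets M"
    unfolding M by (intro sets_PiM_I_finite) auto
  ultimately show ?thesis using A by (auto intro: null_set_Int2)
qed

subsection \<open>Dyadic covers and scales\<close>

text \<open>Used to select dyadic exponents: either the cap B is reached, or failure at the next
  step supplies an inequality in the opposite direction.\<close>

lemma bounded_greatest_nat:
  fixes P :: "nat \<Rightarrow> bool"
  assumes "P 0"
  obtains a where "a \<le> B" "P a" "a = B \<or> \<not> P (Suc a)"
proof -
  have "\<exists>a\<le>B. P a \<and> (a = B \<or> \<not> P (Suc a))"
  proof (induction B)
    case 0
    then show ?case using assms by auto
  next
    case (Suc B)
    then show ?case using le_SucI by blast
  qed
  then show ?thesis using that by blast
qed

definition compositions :: "nat \<Rightarrow> nat \<Rightarrow> (nat \<Rightarrow> nat) set" where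
  "compositions k R = {l \<in> PiE {..<k} (\<lambda>_. {..R}). (\<Sum>j<k. l j) = R}"

lemma finite_compositions [simp]: "finite (compositions k R)"
  unfolding compositions_def by (intro finite_Collect_conjI disjI1) (auto intro: finite_PiE)

text \<open>The first k - 1 parts determine the last one, and each has at most R + 1 values.\<close>

lemma card_compositions_le:
  assumes "k \<ge> 1"
  shows "card (compositions k R) \<le> (R + 1) ^ (k - 1)"
proof -
  obtain q where k: "k = Suc q" using assms by (cases k) auto
  have "inj_on (\<lambda>l. restrict l {..<q}) (compositions k R)"
  proof (rule inj_onI)
    fix l l' assume l: "l \<in> compositions k R" "l' \<in> compositions k R"
      and eq: "restrict l {..<q} = restrict l' {..<q}"
    have lt: "l j = l' j" if "j < q" for j using fun_cong[OF eq, of j] that by simp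
    then have "(\<Sum>j<q. l j) = (\<Sum>j<q. l' j)" by simp
    then have "l q = l' q" using l by (auto simp: compositions_def k)
    then have "\<And>j. j \<in> {..<k} \<Longrightarrow> l j = l' j" using lt
        by (auto simp: k less_Suc_eq)
    moreover have "l \<in> extensional {..<k}" "l' \<in> extensional {..<k}"
      using l by (auto simp: compositions_def PiE_iff)
    ultimately show "l = l'" by (meson extensionalityI)
  qed
  moreover have "(\<lambda>l. restrict l {..<q}) ` compositions k R \<subseteq> PiE {..<q} (\<lambda>_. {..R})"
    by (intro image_subsetI restrict_PiE_iff[THEN iffD2]) (auto simp: compositions_def k PiE_iff)
  ultimately have "card (compositions k R) \<le> card (PiE {..<q} (\<lambda>_. {..R}))"
    by (intro card_inj_on_le) (auto intro: finite_PiE)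
  then show ?thesis by (simp add: card_PiE k)
qed

text \<open>Fill the earlier coordinates as far as possible and put the remainder into the last one.
  Lowering exponents only enlarges a box, so a cover may be indexed by exponents of one exact
  sum.\<close>

lemma exists_smaller_with_sum:
  fixes a :: "nat \<Rightarrow> nat"
  assumes "R \<le> (\<Sum>j<k. a j)"
  shows "\<exists>l. (\<forall>j<k. l j \<le> a j) \<and> (\<Sum>j<k. l j) = R"
  using assms
proof (induction k arbitrary: R)
  case 0
  then show ?case by simp
next
  case (Suc k)
  obtain l where l: "\<forall>j<k. l j \<le> a j" "(\<Sum>j<k. l j) = min R (\<Sum>j<k. a j)"
    using Suc.IH[of "min R (\<Sum>j<k. a j)"] by auto
  define l' where "l' = l(k := R - min R (\<Sum>j<k. a j))"
  have "(\<Sum>j<k. l' j) = (\<Sum>j<k. l j)" by (auto simp: l'_def)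
  moreover have "\<forall>j<Suc k. l' j \<le> a j"
    using l(1) Suc.prems by (auto simp: l'_def less_Suc_eq)
  ultimately show ?case using l(2) by (intro exI[of _ l']) (simp add: l'_def)
qed

text \<open>Let a j record the dyadic size of t j, capped at r. If a cap is reached, the sum of the
  a j is at least r. Otherwise every t j exceeds 2^(-(a j + 4)), and the product hypothesis forces
  the sum of the a j + 4 above r. The loss of 4 per coordinate is the offset 3 of
  \<open>near_event\<close> plus 1 for dyadic rounding.\<close>

lemma small_product_dyadic_box:
  fixes t :: "nat \<Rightarrow> real"
  assumes t: "\<And>j. j < k \<Longrightarrow> t j \<ge> 0"
      and prod: "(\<Prod>j<k. t j) < 1 / 2 ^ r"
  shows "\<exists>l\<in>compositions k (r - 4 * k). \<forall>j<k. l j = 0 \<or> t j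
      \<le> 1 / 2 ^ (l j + 3)"
proof -
  \<comment> \<open>The cap r is needed because t j may be 0; the alternative a = 0 covers t j >
    1/8.\<close>
  have "\<exists>a\<le>r. (a = 0 \<or> t j
      \<le> 1 / 2 ^ (a + 3)) \<and> (a = r \<or> t j > 1 / 2 ^ (a + 4))" for j
    by (rule bounded_greatest_nat[of "\<lambda>a. a = 0 \<or> t j \<le> 1 / 2 ^ (a + 3)" r])
       (auto simp: not_le add.commute numeral_eq_Suc)
  then obtain a where a: "\<And>j. a j \<le> r" "\<And>j. a j = 0 \<or> t j \<le> 1 / 2 ^ (a j + 3)"
      "\<And>j. a j = r \<or> t j > 1 / 2 ^ (a j + 4)"
    by metis
  have "r - 4 * k \<le> (\<Sum>j<k. a j)"
  proof (cases "\<exists>j<k. a j = r")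
    case True
    then obtain j where "j < k" "a j = r" by auto
    then show ?thesis using member_le_sum[of j "{..<k}" a] by auto
  next
    case False
    have "(\<Prod>j<k. 1 / 2 ^ (a j + 4)) \<le> (\<Prod>j<k. t j)"
      by (rule prod_mono) (use a(3) False in \<open>auto intro: less_imp_le\<close>)
    also have "(\<Prod>j<k. 1 / 2 ^ (a j + 4) :: real) = 1 / 2 ^ (\<Sum>j<k. a j + 4)"
      by (simp only: prod_dividef prod.neutral_const power_sum)
    finally have "1 / 2 ^ (\<Sum>j<k. a j + 4) < (1 / 2 ^ r :: real)" using prod by linarith
    then have "(2::real) ^ r < 2 ^ (\<Sum>j<k. a j + 4)" by (simp add: field_simps)
    then have "r < (\<Sum>j<k. a j + 4)" by simp
    then show ?thesis by (simp add: sum.distrib)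
  qed
  then obtain l where l: "\<forall>j<k. l j \<le> a j" "(\<Sum>j<k. l j) = r - 4 * k"
    using exists_smaller_with_sum by blast
  define l' where "l' = restrict l {..<k}"
  have sum_l': "(\<Sum>j<k. l' j) = r - 4 * k" using l(2) by (simp add: l'_def)
  have "l' j \<le> r - 4 * k" if "j < k" for j
    using member_le_sum[of j "{..<k}" l'] that sum_l' by auto
  then have "l' \<in> compositions k (r - 4 * k)"
    using sum_l' by (auto simp: compositions_def PiE_iff l'_def)
  moreover have "l' j = 0 \<or> t j \<le> 1 / 2 ^ (l' j + 3)" if j: "j < k" for j
  proof (cases "l' j = 0")
    case False
    then have "l' j \<le> a j" "a j \<noteq> 0" using l(1) j by (auto simp: l'_def)
    then have "t j \<le> 1 / 2 ^ (a j + 3)" using a(2)[of j] by auto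
    also have "\<dots> \<le> 1 / 2 ^ (l' j + 3)"
      using \<open>l' j \<le> a j\<close> by (intro divide_left_mono power_increasing) auto
    finally show ?thesis by simp
  qed simp
  ultimately show ?thesis by blast
qed

section \<open>Condensation and the choice of dyadic exponents\<close>

text \<open>Cauchy condensation with a logarithmic weight. The weighted terms need not be monotone,
  so the two factors are bounded separately: on the block from 2^m to 2^(m+1), \<phi> is at least
  its value at 2^(m+1) and the logarithm is at least m ln 2.\<close>

lemma summable_condensed_log:
  fixes \<phi> :: "nat \<Rightarrow> real"
  assumes \<phi>: "antimono \<phi>" "\<And>n. \<phi> n \<ge> 0"
      and sum: "summable (\<lambda>n. \<phi> n * ln (real n) ^ q)"
  shows "summable (\<lambda>m. real m ^ q * (2 ^ m * \<phi> (2 ^ m)))"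
proof -
  let ?b = "\<lambda>m. \<Sum>n\<in>{2^m..<2^(m+1)}. \<phi> n * ln (real n) ^ q"
  have ln0: "ln (real n) \<ge> 0" for n by (cases "n = 0") auto
  have "summable ?b"
    using sum by (subst summable_dyadic_blocks_iff) (auto intro!: mult_nonneg_nonneg zero_le_power \<phi> ln0)
  then have "summable (\<lambda>m. 2 * (2 / ln 2) ^ q * ?b m)" by (rule summable_mult)
  then have "summable (\<lambda>m. real (Suc m) ^ q * (2 ^ Suc m * \<phi> (2 ^ Suc m)))"
  proof (rule summable_comparison_test[rotated], intro exI[of _ 1] allI impI)
    fix m :: nat assume m: "m \<ge> 1"
    have "2 ^ m * (\<phi> (2 ^ Suc m) * (real m * ln 2) ^ q)
        = (\<Sum>n\<in>{2^m..<(2::nat)^(m+1)}. \<phi> (2 ^ Suc m) * (real m * ln 2) ^ q)"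
      by simp
    also have "\<dots> \<le> ?b m"
    proof (intro sum_mono mult_mono power_mono)
      fix n assume n: "n \<in> {2^m..<(2::nat)^(m+1)}"
      show "\<phi> (2 ^ Suc m) \<le> \<phi> n" using n by (intro antimonoD[OF \<phi>(1)]) auto
      have "real (2 ^ m) \<le> real n" using n by (subst of_nat_le_iff) auto
      then have "ln (2 ^ m) \<le> ln (real n)"
        by (intro ln_mono) (auto intro: less_le_trans[of 0 "2 ^ m"])
      then show "real m * ln 2 \<le> ln (real n)" by (simp add: ln_realpow)
    qed (use \<phi> in \<open>auto intro!: ln0\<close>)
    finally have *: "2 ^ m * (\<phi> (2 ^ Suc m) * (real m * ln 2) ^ q) \<le> ?b m" .
    \<comment> \<open>This is m + 1 \<le> 2m, the reason for starting at m = 1.\<close>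
    have "real (Suc m) ^ q \<le> ((2 / ln 2) * (real m * ln 2)) ^ q"
      using m by (intro power_mono) auto
    then have "real (Suc m) ^ q * (2 ^ Suc m * \<phi> (2 ^ Suc m))
        \<le> ((2 / ln 2) * (real m * ln 2)) ^ q * (2 ^ Suc m * \<phi> (2 ^ Suc m))"
      using \<phi> by (intro mult_right_mono) auto
    also have "\<dots> = 2 * (2 / ln 2) ^ q * (2 ^ m * (\<phi> (2 ^ Suc m) * (real m * ln 2) ^ q))"
      by (simp only: power_mult_distrib power_Suc mult_ac)
    also have "\<dots> \<le> 2 * (2 / ln 2) ^ q * ?b m"
      using * by (intro mult_left_mono) auto
    finally show "norm (real (Suc m) ^ q * (2 ^ Suc m * \<phi> (2 ^ Suc m)))
        \<le> 2 * (2 / ln 2) ^ q * ?b m"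
      using \<phi> by simp
  qed
  then show ?thesis by (subst (asm) summable_Suc_iff)
qed

lemma summable_power_times_geometric:
  fixes e :: real
  assumes "e > 0"
  shows "summable (\<lambda>m. real m ^ q * (2 powr (- e)) ^ m)"
proof -
  \<comment> \<open>With d q \<le> e/2 the power m^q uses up at most half of the decay; the 1 in the
    denominator covers q = 0.\<close>
  define d where "d = e / (2 * (real q + 1))"
  have d: "d > 0" "d * real q \<le> e / 2" using assms by (auto simp: d_def field_simps)
  obtain K where K: "K \<ge> 1" "\<And>a::nat. real (a + 1) \<le> K * 2 powr (d * real a)"
    using linear_le_const_times_exp[OF d(1)] by blast
  have "2 powr (- e / 2) < 1" using assms by (intro powr_less_one) auto
  then have "summable (\<lambda>m. K ^ q * (2 powr (- e / 2)) ^ m)"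
    by (intro summable_mult summable_geometric) auto
  then show ?thesis
  proof (rule summable_comparison_test[rotated], intro exI allI impI)
    fix m :: nat
    have "real m ^ q \<le> (K * 2 powr (d * real m)) ^ q"
      using K(2)[of m] by (intro power_mono) auto
    also have "\<dots> = K ^ q * 2 powr (d * real q * real m)"
      by (simp add: power_mult_distrib powr_realpow[symmetric] powr_powr mult_ac)
    also have "\<dots> \<le> K ^ q * 2 powr (e / 2 * real m)"
      using d K by (intro mult_left_mono powr_mono mult_right_mono) auto
    finally have "real m ^ q * (2 powr (- e)) ^ m
        \<le> K ^ q * 2 powr (e / 2 * real m) * (2 powr (- e)) ^ m"
      by (intro mult_right_mono) auto
    also have "\<dots> = K ^ q * (2 powr (e / 2 * real m) * 2 powr (- e * real m))"
      by (simp add: powr_realpow[symmetric] powr_powr)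
    also have "2 powr (e / 2 * real m) * 2 powr (- e * real m) = 2 powr (- e / 2 * real m)"
      unfolding powr_add[symmetric] by (simp add: algebra_simps)
    also have "2 powr (- e / 2 * real m) = (2 powr (- e / 2)) ^ m"
      by (simp only: powr_powr[symmetric]) (simp add: powr_realpow)
    finally show "norm (real m ^ q * (2 powr (- e)) ^ m) \<le> K ^ q * (2 powr (- e / 2)) ^ m"
      by simp
  qed
qed

text \<open>Capping the dyadic exponent at (1 + \<epsilon>) m / p amounts to enlarging \<psi>(2^m) to at least 2^(-(1 +
  \<epsilon>) m / p), which keeps the series convergent.\<close>

lemma dyadic_scale:
  fixes \<psi> :: "nat \<Rightarrow> real"
  assumes \<psi>: "\<And>n. 0 \<le> \<psi> n" "\<And>n. \<psi> n < 1" "antimono \<psi>"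
    and sum: "summable (\<lambda>n. \<psi> n ^ p * ln (real n) ^ q)" and p: "p \<ge> 1"
        and \<epsilon>: "\<epsilon> > (0::real)"
  obtains r :: "nat \<Rightarrow> nat" where "\<And>m. \<psi> (2 ^ m) \<le> 1 / 2 ^ r m"
    "\<And>m. real (p * r m) \<le> (1 + \<epsilon>) * real m"
    "summable (\<lambda>m. real m ^ q * (2 ^ m / 2 ^ (p * r m)))"
proof -
  define B where "B m = nat \<lfloor>(1 + \<epsilon>) * real m / real p\<rfloor>" for m
  have B: "real (B m) \<le> (1 + \<epsilon>) * real m / real p" "(1 + \<epsilon>) * real m / real p < real (B m) + 1" for m
  proof -
    have "(1 + \<epsilon>) * real m / real p \<ge> 0" using \<epsilon> by simp
    then have "real (B m) = of_int \<lfloor>(1 + \<epsilon>) * real m / real p\<rfloor>"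
        by (simp add: B_def)
    then show "real (B m) \<le> (1 + \<epsilon>) * real m / real p" "(1 + \<epsilon>) * real m / real p < real (B m) + 1"
      by linarith+
  qed
  have "\<exists>r\<le>B m. \<psi> (2 ^ m)
      \<le> 1 / 2 ^ r \<and> (r = B m \<or> \<not> \<psi> (2 ^ m) \<le> 1 / 2 ^ Suc r)" for m
    by (rule bounded_greatest_nat[of "\<lambda>r. \<psi> (2 ^ m) \<le> 1 / 2 ^ r" "B m"])
       (use \<psi>(2)[of "2 ^ m"] in auto)
  then obtain r where r: "\<And>m. r m \<le> B m" "\<And>m. \<psi> (2 ^ m) \<le> 1 / 2 ^ r m"
      "\<And>m. r m = B m \<or> \<not> \<psi> (2 ^ m) \<le> 1 / 2 ^ Suc (r m)"
    by metis
  define x where "x = 2 powr (- \<epsilon>)"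
  have x: "0 < x" "x < 1" using \<epsilon> by (auto simp: x_def powr_less_one)
  \<comment> \<open>If the cap is attained, the term decays like 2^(-\<epsilon> m). If not,
    maximality of r m gives 2^(-r m) < 2 \<psi>(2^m), and the term is controlled by the condensed
    series.\<close>
  have bound: "2 ^ m / 2 ^ (p * r m) \<le> 2 ^ p * (2 ^ m * \<psi> (2 ^ m) ^ p) + 2 ^ p * x ^ m" for m
  proof (cases "r m = B m")
    case True
    have "(1 + \<epsilon>) * real m \<le> real p * (real (B m) + 1)"
      using B(2)[of m] p by (simp add: field_simps)
    then have e: "real m - real (p * r m) \<le> real p + (- \<epsilon>) * real m"
      using True by (simp add: algebra_simps)
    have "2 ^ m / 2 ^ (p * r m) = 2 powr (real m - real (p * r m))"
      by (simp only: powr_diff powr_realpow[symmetric] zero_less_numeral)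
    also have "\<dots> \<le> 2 powr (real p + (- \<epsilon>) * real m)"
      using e by (intro powr_mono) auto
    also have "\<dots> = 2 ^ p * x ^ m"
      by (simp only: powr_add powr_realpow zero_less_numeral x_def powr_powr[symmetric] powr_gt_zero)
    finally show ?thesis using \<psi>(1)[of "2 ^ m"] by (simp add: add_increasing)
  next
    case False
    then have "1 / 2 ^ r m \<le> 2 * \<psi> (2 ^ m)" using r(3)[of m] by auto
    then have "(1 / 2 ^ r m) ^ p \<le> (2 * \<psi> (2 ^ m)) ^ p" by (intro power_mono) auto
    then have "2 ^ m * (1 / 2 ^ (p * r m)) \<le> 2 ^ m * (2 ^ p * \<psi> (2 ^ m) ^ p)"
      by (intro mult_left_mono) (auto simp: power_divide power_mult_distrib power_mult[symmetric] mult.commute)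
    then show ?thesis using x by (simp add: mult_ac add_increasing2)
  qed
  show ?thesis
  proof (rule that[of r])
    show "\<psi> (2 ^ m) \<le> 1 / 2 ^ r m" for m by (rule r(2))
    show "real (p * r m) \<le> (1 + \<epsilon>) * real m" for m
    proof -
      have "real p * real (r m) \<le> real p * ((1 + \<epsilon>) * real m / real p)"
        using r(1)[of m] B(1)[of m] by (intro mult_left_mono) auto
      then show ?thesis using p by simp
    qed
    have "antimono (\<lambda>n. \<psi> n ^ p)"
      using \<psi> by (auto simp: antimono_def intro!: power_mono)
    then have "summable (\<lambda>m. real m ^ q * (2 ^ m * \<psi> (2 ^ m) ^ p))"
      using \<psi> sum by (intro summable_condensed_log) auto
    then have "summable (\<lambda>m. 2 ^ p * (real m ^ q * (2 ^ m * \<psi> (2 ^ m) ^ p)) + 2 ^ p * (real m ^ q * x ^ m))"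
      by (intro summable_add summable_mult) (auto simp: x_def intro: summable_power_times_geometric \<epsilon>)
    then show "summable (\<lambda>m. real m ^ q * (2 ^ m / 2 ^ (p * r m)))"
    proof (rule summable_comparison_test[rotated], intro exI allI impI)
      fix m
      have "real m ^ q * (2 ^ m / 2 ^ (p * r m))
          \<le> real m ^ q * (2 ^ p * (2 ^ m * \<psi> (2 ^ m) ^ p) + 2 ^ p * x ^ m)"
        by (intro mult_left_mono bound) auto
      then show "norm (real m ^ q * (2 ^ m / 2 ^ (p * r m)))
          \<le> 2 ^ p * (real m ^ q * (2 ^ m * \<psi> (2 ^ m) ^ p)) + 2 ^ p * (real m ^ q * x ^ m)"
        by (simp add: algebra_simps)
    qed
  qed
qed

subsection \<open>Convergence results\<close>

lemma int_abs_le_eq: "{i::int. \<bar>real_of_int i\<bar>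
    \<le> Q} = {- \<lfloor>Q\<rfloor>..\<lfloor>Q\<rfloor>}"
  by (auto simp: le_floor_iff abs_le_iff minus_le_iff)

lemma card_int_abs_le:
  assumes "Q \<ge> 1"
  shows "real (card {i::int. \<bar>real_of_int i\<bar> \<le> Q}) \<le> 3 * Q"
proof -
  have "\<lfloor>Q\<rfloor> \<ge> 1" using assms by simp
  then have "real (card {i::int. \<bar>real_of_int i\<bar>
      \<le> Q}) = 2 * of_int \<lfloor>Q\<rfloor> + 1"
    unfolding int_abs_le_eq by simp
  also have "\<dots> \<le> 3 * Q" using assms of_int_floor_le[of Q] by linarith
  finally show ?thesis .
qed

lemma cmod_fourier_coeff_le_1:
  assumes "prob_space M"
  shows "cmod (fourier_coeff k M \<xi>) \<le> 1"
proof -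
  interpret prob_space M by fact
  have "cmod (fourier_coeff k M \<xi>) \<le> (\<integral>x. cmod (cis (- 2 * pi * (\<Sum>j<k. real_of_int (\<xi> j) * x j))) \<partial>M)"
    unfolding fourier_coeff_def by (rule integral_norm_bound)
  then show ?thesis by (simp add: prob_space)
qed

lemma cmod_fourier_coeff1_le_1:
  assumes "prob_space M"
  shows "cmod (fourier_coeff1 M \<xi>) \<le> 1"
proof -
  interpret prob_space M by fact
  have "cmod (fourier_coeff1 M \<xi>) \<le> (\<integral>x. cmod (cis (- 2 * pi * real_of_int \<xi> * x)) \<partial>M)"
    unfolding fourier_coeff1_def by (rule integral_norm_bound)
  then show ?thesis by (simp add: prob_space)
qed

text \<open>The trivial bound |\<mu>^(\<xi>)| \<le> 1 puts 0 into the set of admissible exponents. A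
  nonempty set whose supremum exceeds a has an element above a.\<close>

lemma l1dim_gtE:
  assumes "prob_space M" "l1dim k M > a"
  obtains s C where "s > a" "C \<ge> 0"
    "\<And>Q. Q \<ge> 1 \<Longrightarrow> (\<Sum>\<xi>\<in>int_box k Q. cmod (fourier_coeff k M \<xi>)) \<le> C * Q powr (real k - s)"
proof -
  let ?S = "{s. s \<ge> 0 \<and> (\<exists>C. \<forall>Q\<ge>1.
      (\<Sum>\<xi>\<in>int_box k Q. cmod (fourier_coeff k M \<xi>)) \<le> C * Q powr (real k - s))}"
  have "0 \<in> ?S"
  proof (intro CollectI conjI exI[of _ "3 ^ k"] allI impI)
    fix Q :: real assume Q: "Q \<ge> 1"
    have "(\<Sum>\<xi>\<in>int_box k Q. cmod (fourier_coeff k M \<xi>))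
        \<le> (\<Sum>\<xi>\<in>int_box k Q. 1)"
      by (intro sum_mono cmod_fourier_coeff_le_1 assms)
    also have "\<dots> = real (card {i::int. \<bar>real_of_int i\<bar> \<le> Q}) ^ k"
      by (simp add: int_box_def card_PiE)
    also have "\<dots> \<le> (3 * Q) ^ k" using Q by (intro power_mono card_int_abs_le) auto
    also have "\<dots> = 3 ^ k * Q powr (real k - 0)" using Q
        by (simp add: power_mult_distrib powr_realpow)
    finally show "(\<Sum>\<xi>\<in>int_box k Q. cmod (fourier_coeff k M \<xi>))
        \<le> 3 ^ k * Q powr (real k - 0)" .
  qed simp
  then have "\<exists>s\<in>?S. s > a"
    using assms(2) unfolding l1dim_def by (metis (no_types, lifting) cSup_least empty_iff not_le)
  then obtain s C where s: "s > a" and C: "\<And>Q. Q \<ge> 1 \<Longrightarrow>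
      (\<Sum>\<xi>\<in>int_box k Q. cmod (fourier_coeff k M \<xi>)) \<le> C * Q powr (real k - s)"
    by auto
  have "0 \<le> (\<Sum>\<xi>\<in>int_box k 1. cmod (fourier_coeff k M \<xi>))"
      by (intro sum_nonneg) auto
  then have "C \<ge> 0" using C[of 1] by simp
  then show ?thesis using that s C by blast
qed

lemma l1dim1_gtE:
  assumes "prob_space M" "l1dim1 M > a"
  obtains s C where "s > a" "C \<ge> 0"
    "\<And>Q. Q \<ge> 1 \<Longrightarrow> (\<Sum>\<xi>\<in>{i::int. \<bar>real_of_int i\<bar>
        \<le> Q}. cmod (fourier_coeff1 M \<xi>)) \<le> C * Q powr (1 - s)"
proof -
  let ?S = "{s. s \<ge> 0 \<and> (\<exists>C. \<forall>Q\<ge>1.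
      (\<Sum>\<xi>\<in>{i::int. \<bar>real_of_int i\<bar> \<le> Q}. cmod (fourier_coeff1 M \<xi>))
          \<le> C * Q powr (1 - s))}"
  have "0 \<in> ?S"
  proof (intro CollectI conjI exI[of _ 3] allI impI)
    fix Q :: real assume Q: "Q \<ge> 1"
    have "(\<Sum>\<xi>\<in>{i::int. \<bar>real_of_int i\<bar>
        \<le> Q}. cmod (fourier_coeff1 M \<xi>))
            \<le> (\<Sum>\<xi>\<in>{i::int. \<bar>real_of_int i\<bar> \<le> Q}. 1)"
      by (intro sum_mono cmod_fourier_coeff1_le_1 assms)
    also have "\<dots> \<le> 3 * Q powr (1 - 0)" using card_int_abs_le[OF Q] Q by simp
    finally show "(\<Sum>\<xi>\<in>{i::int. \<bar>real_of_int i\<bar>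
        \<le> Q}. cmod (fourier_coeff1 M \<xi>)) \<le> 3 * Q powr (1 - 0)" .
  qed simp
  then have "\<exists>s\<in>?S. s > a"
    using assms(2) unfolding l1dim1_def by (metis (no_types, lifting) cSup_least empty_iff not_le)
  then obtain s C where s: "s > a" and C: "\<And>Q. Q \<ge> 1 \<Longrightarrow>
      (\<Sum>\<xi>\<in>{i::int. \<bar>real_of_int i\<bar> \<le> Q}. cmod (fourier_coeff1 M \<xi>))
          \<le> C * Q powr (1 - s)"
    by auto
  have "0 \<le> (\<Sum>\<xi>\<in>{i::int. \<bar>real_of_int i\<bar>
      \<le> 1}. cmod (fourier_coeff1 M \<xi>))" by (intro sum_nonneg) auto
  then have "C \<ge> 0" using C[of 1] by simp
  then show ?thesis using that s C by blast
qed

lemma dyadic_interval_eq: "{- (2 ^ l)..2 ^ l} = {i::int. \<bar>real_of_int i\<bar> \<le> 2 ^ l}"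
  unfolding int_abs_le_eq by simp

section \<open>The Khinchin case: cubes\<close>

lemma inhom_conv_khinchin_if_l1dim:
  assumes k: "k \<ge> 1" and M: "borel_prob_cube k M"
    and dim: "l1dim k M > real k - real k / (real k + 1)"
  shows "inhom_conv_khinchin k M"
  unfolding inhom_conv_khinchin_def
proof (intro allI impI, elim conjE)
  fix \<psi> :: "nat \<Rightarrow> real" and y
  assume \<psi>: "\<forall>n. 0 \<le> \<psi> n \<and> \<psi> n < 1" "antimono \<psi>"
      and sum: "summable (\<lambda>n. \<psi> n ^ k)"
  have P: "prob_space M" and S: "sets M = sets (PiM {..<k} (\<lambda>_. borel))"
    using M by (auto simp: borel_prob_cube_def)
  interpret prob_space M by (rule P)
  obtain s C where s: "s > real k - real k / (real k + 1)" and C: "C \<ge> 0"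
    "\<And>Q. Q \<ge> 1 \<Longrightarrow> (\<Sum>\<xi>\<in>int_box k Q. cmod (fourier_coeff k M \<xi>)) \<le> C * Q powr (real k - s)"
    using l1dim_gtE[OF P dim] by blast
  \<comment> \<open>The spectral exponent per coordinate; the dimension hypothesis says exactly that
    it lies below 1/(k+1). The maximum with 0 saves proving s \<le> k.\<close>
  define \<tau> where "\<tau> = max 0 ((real k - s) / real k)"
  have \<tau>: "\<tau> \<ge> 0" "\<tau> * (real k + 1) < 1" "real k - s \<le> \<tau> * real k"
  proof -
    show "\<tau> \<ge> 0" by (simp add: \<tau>_def)
    have "real k - s < real k / (real k + 1)" using s by linarith
    then have "(real k - s) / real k < 1 / (real k + 1)"
      using k by (simp add: field_simps)
    then have "\<tau> < 1 / (real k + 1)" by (simp add: \<tau>_def)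
    then show "\<tau> * (real k + 1) < 1" by (simp add: field_simps)
    have "(real k - s) / real k * real k \<le> \<tau> * real k"
      unfolding \<tau>_def by (intro mult_right_mono) auto
    then show "real k - s \<le> \<tau> * real k" using k by simp
  qed
  obtain \<epsilon> K where \<epsilon>: "\<epsilon> > 0" and K: "K \<ge> 0"
    "\<And>m l y. \<lbrakk>real (\<Sum>j<k. l j) \<le> (1 + \<epsilon>) * real m;
       (\<Sum>\<xi>\<in>freq_box k (\<lambda>j. l j + (m + 1)). cmod (fourier_coeff k M \<xi>))
         \<le> C * 2 powr (\<tau> * real (\<Sum>j<k. l j + (m + 1)))\<rbrakk>
     \<Longrightarrow> (\<Sum>n\<in>{2^m..<2^(m+1)}. measure M (near_event k y n l))
         \<le> K * (2 ^ m / 2 ^ (\<Sum>j<k. l j))"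
    using block_sum_near_event_le[OF P S \<tau>(1,2) C(1)] by metis
  have "summable (\<lambda>n. \<psi> n ^ k * ln (real n) ^ 0)" using sum by simp
  then obtain r where r: "\<And>m. \<psi> (2 ^ m) \<le> 1 / 2 ^ r m" "\<And>m. real (k * r m)
      \<le> (1 + \<epsilon>) * real m"
    "summable (\<lambda>m. real m ^ 0 * (2 ^ m / 2 ^ (k * r m)))"
    using dyadic_scale[OF _ _ \<psi>(2) _ k \<epsilon>, of 0] \<psi>(1) by blast
  \<comment> \<open>Subtracting 3 cancels the offset in \<open>near_event\<close>, so the threshold
    becomes 2^(-r m). For r m \<le> 3 the result is 0 and the event is unconstrained.\<close>
  define L where "L m = (\<lambda>j::nat. r m - 3)" for m
  define A where "A n = {x \<in> space M. n \<ge> 1 \<and> (\<forall>j<k. dist_nint (real n * x j - y j) < \<psi> n)}" for n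
  have "limsup A \<in> null_sets M"
  proof (rule limsup_null_if_dyadic_cover[OF P S, where y = y and LL = "\<lambda>m. {L m}"
        and b = "\<lambda>m. K * (2 ^ m / 2 ^ (k * (r m - 3)))"])
    show "A n \<in> sets M" for n
    proof -
      have [measurable]: "(\<lambda>x. dist_nint (real n * x j - y j)) \<in> borel_measurable M" if "j \<in> {..<k}" for j
        using that measurable_dist_nint_component[of j k n y]
            by (simp add: measurable_cong_sets[OF S refl])
      have "A n = {x \<in> space M. n \<ge> 1 \<and> (\<forall>j\<in>{..<k}. dist_nint (real n * x j - y j) < \<psi> n)}"
        by (auto simp: A_def)
      also have "\<dots> \<in> sets M" by measurable
      finally show ?thesis .
    qed
    show "A n \<subseteq> (\<Union>l\<in>{L m}. near_event k y n l)" if "2 ^ m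
        \<le> n" "n < 2 ^ (m + 1)" for m n
    proof
      fix x assume x: "x \<in> A n"
      have "\<psi> n \<le> \<psi> (2 ^ m)" using that \<psi>(2) by (auto simp: antimono_def)
      then have \<psi>n: "\<psi> n \<le> 1 / 2 ^ r m" using r(1)[of m] by linarith
      have "L m j = 0 \<or> dist_nint (real n * x j - y j)
          \<le> 1 / 2 ^ (L m j + 3)" if "j < k" for j
      proof (cases "r m \<ge> 3")
        case True
        then have "L m j + 3 = r m" by (simp add: L_def)
        then show ?thesis using x that \<psi>n
            by (auto simp: A_def intro: less_imp_le less_le_trans)
      qed (simp add: L_def)
      moreover have "x \<in> PiE {..<k} (\<lambda>_. UNIV)"
        using x sets_eq_imp_space_eq[OF S] by (auto simp: A_def space_PiM)
      ultimately show "x \<in> (\<Union>l\<in>{L m}. near_event k y n l)"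
        by (simp add: near_event_def)
    qed
    show "(\<Sum>n\<in>{2^m..<2^(m+1)}. measure M (near_event k y n l))
        \<le> K * (2 ^ m / 2 ^ (k * (r m - 3)))"
      if "l \<in> {L m}" for m l
    proof -
      have l: "l = L m" using that by simp
      have sum_l: "(\<Sum>j<k. l j) = k * (r m - 3)" by (simp add: l L_def)
      have "k * (r m - 3) \<le> k * r m" by simp
      then have "real (\<Sum>j<k. l j) \<le> (1 + \<epsilon>) * real m"
        unfolding sum_l using r(2)[of m] by (meson of_nat_le_iff order_trans)
      moreover have "(\<Sum>\<xi>\<in>freq_box k (\<lambda>j. l j + (m + 1)). cmod (fourier_coeff k M \<xi>))
         \<le> C * 2 powr (\<tau> * real (\<Sum>j<k. l j + (m + 1)))"
      proof -
        \<comment> \<open>All sides are equal, so the enlarged frequency box is a cube and the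
          dimension bound applies at Q = 2^N.\<close>
        define N where "N = r m - 3 + (m + 1)"
        have "freq_box k (\<lambda>j. l j + (m + 1)) = int_box k (2 ^ N)"
          unfolding freq_box_def int_box_def dyadic_interval_eq by (simp add: l L_def N_def)
        then have "(\<Sum>\<xi>\<in>freq_box k (\<lambda>j. l j + (m + 1)). cmod (fourier_coeff k M \<xi>))
            \<le> C * (2 ^ N) powr (real k - s)"
          using C(2)[of "2 ^ N"] by simp
        also have "(2 ^ N) powr (real k - s) \<le> (2 ^ N) powr (\<tau> * real k)"
          using \<tau>(3) by (intro powr_mono) auto
        also have "(2 ^ N) powr (\<tau> * real k) = 2 powr (real N * (\<tau> * real k))"
          by (simp only: powr_realpow[symmetric] powr_powr zero_less_numeral)
        also have "real N * (\<tau> * real k) = \<tau> * real (\<Sum>j<k. l j + (m + 1))"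
        proof -
          have "(\<Sum>j<k. l j + (m + 1)) = k * N" by (simp add: l L_def N_def)
          then show ?thesis by (simp only: of_nat_mult mult_ac)
        qed
        finally show ?thesis using C(1) by (simp add: mult_left_mono)
      qed
      ultimately show ?thesis using K(2)[of l m y] unfolding sum_l by blast
    qed
    \<comment> \<open>The factor 2^(3k) pays for lowering the exponent by at most 3 in each of the k
      coordinates.\<close>
    have "summable (\<lambda>m. K * 2 ^ (k * 3) * (2 ^ m / 2 ^ (k * r m)))"
      using r(3) by (intro summable_mult) simp
    then show "summable (\<lambda>m. real (card {L m}) * (K * (2 ^ m / 2 ^ (k * (r m - 3)))))"
    proof (rule summable_comparison_test[rotated], intro exI allI impI)
      fix m
      have "k * r m \<le> k * 3 + k * (r m - 3)" unfolding distrib_left[symmetric]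
          by (intro mult_left_mono) auto
      then have "(2::real) ^ (k * r m) \<le> 2 ^ (k * 3 + k * (r m - 3))"
          by (intro power_increasing) auto
      then have "1 / 2 ^ (k * (r m - 3)) \<le> (2 ^ (k * 3) / 2 ^ (k * r m) :: real)"
        by (simp only: power_add) (simp add: field_simps)
      then have "(K * 2 ^ m) * (1 / 2 ^ (k * (r m - 3)))
          \<le> (K * 2 ^ m) * (2 ^ (k * 3) / 2 ^ (k * r m))"
        using K(1) by (intro mult_left_mono) auto
      then show "norm (real (card {L m}) * (K * (2 ^ m / 2 ^ (k * (r m - 3)))))
          \<le> K * 2 ^ (k * 3) * (2 ^ m / 2 ^ (k * r m))"
        using K(1) by (simp add: mult_ac)
    qed
  qed simp
  then show "W_set k \<psi> y \<in> null_sets M"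
    unfolding W_set_def by (rule null_sets_infinitely_often[OF S]) (simp add: A_def)
qed

section \<open>The Gallagher case: product measures\<close>

lemma fourier_coeff_PiM:
  assumes \<mu>: "\<And>j. j < k \<Longrightarrow> prob_space (\<mu>s j)" "\<And>j. j < k
      \<Longrightarrow> sets (\<mu>s j) = sets borel"
  shows "fourier_coeff k (PiM {..<k} \<mu>s) \<xi>
      = (\<Prod>j<k. fourier_coeff1 (\<mu>s j) (\<xi> j))"
proof -
  \<comment> \<open>The locale \<open>product_sigma_finite\<close> speaks of all indices, so the
    family is padded with point masses.\<close>
  define \<nu> where "\<nu> j = (if j < k then \<mu>s j else return borel 0)" for j
  have \<nu>: "prob_space (\<nu> j)" for j using \<mu>(1)
      by (auto simp: \<nu>_def intro: prob_space_return)
  interpret product_sigma_finite \<nu>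
    by (rule product_sigma_finite.intro) (use \<nu> prob_space_imp_sigma_finite in blast)
  have eq: "PiM {..<k} \<mu>s = PiM {..<k} \<nu>" by (rule PiM_cong) (auto simp: \<nu>_def)
  have int: "integrable (\<nu> j) (\<lambda>t. cis (- 2 * pi * real_of_int (\<xi> j) * t))" if "j \<in> {..<k}" for j
  proof -
    interpret prob_space "\<nu> j" by (rule \<nu>)
    have "(\<lambda>t. cis (- 2 * pi * real_of_int (\<xi> j) * t)) \<in> borel_measurable borel"
      by (intro borel_measurable_continuous_onI continuous_intros)
    moreover have "sets (\<nu> j) = sets borel" using that \<mu>(2) by (simp add: \<nu>_def)
    ultimately have "(\<lambda>t. cis (- 2 * pi * real_of_int (\<xi> j) * t)) \<in> borel_measurable (\<nu> j)"
      using measurable_cong_sets[of "\<nu> j" borel borel borel] by blast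
    then show ?thesis by (intro integrable_const_bound[of _ 1]) auto
  qed
  have "fourier_coeff k (PiM {..<k} \<mu>s) \<xi>
      = (\<integral>x. (\<Prod>j<k. cis (- 2 * pi * real_of_int (\<xi> j) * x j)) \<partial>PiM {..<k} \<nu>)"
    unfolding fourier_coeff_def eq prod_cis sum_distrib_left by (simp only: mult.assoc)
  also have "\<dots> = (\<Prod>j<k. \<integral>t. cis (- 2 * pi * real_of_int (\<xi> j) * t) \<partial>\<nu> j)"
    by (rule product_integral_prod) (use int in auto)
  also have "\<dots> = (\<Prod>j<k. fourier_coeff1 (\<mu>s j) (\<xi> j))"
    by (simp add: \<nu>_def fourier_coeff1_def)
  finally show ?thesis .
qed

lemma inhom_conv_gallagher_if_l1dim1:
  assumes k: "k \<ge> 1"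
    and \<mu>: "\<And>j. j < k \<Longrightarrow> borel_prob_unit (\<mu>s j)"
    and dim: "\<And>j. j < k \<Longrightarrow> l1dim1 (\<mu>s j) > 1 - 1 / (real k + 1)"
  shows "inhom_conv_gallagher k (PiM {..<k} \<mu>s)"
  unfolding inhom_conv_gallagher_def
proof (intro allI impI, elim conjE)
  fix \<psi> :: "nat \<Rightarrow> real" and y
  assume \<psi>: "\<forall>n. 0 \<le> \<psi> n \<and> \<psi> n < 1" "antimono \<psi>"
    and sum: "summable (\<lambda>n. \<psi> n * ln (real n) ^ (k - 1))"
  define M where "M = PiM {..<k} \<mu>s"
  have \<mu>P: "prob_space (\<mu>s j)" and \<mu>S: "sets (\<mu>s j) = sets borel" if "j < k" for j
    using \<mu>[OF that] by (auto simp: borel_prob_unit_def)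
  have P: "prob_space M" unfolding M_def by (rule prob_space_PiM) (use \<mu>P in auto)
  have S: "sets M = sets (PiM {..<k} (\<lambda>_. borel))"
    unfolding M_def by (rule sets_PiM_cong) (use \<mu>S in auto)
  interpret prob_space M by (rule P)
  have "\<exists>s C. s > 1 - 1 / (real k + 1) \<and> C \<ge> 0 \<and> (\<forall>Q\<ge>1.
      (\<Sum>\<xi>\<in>{i::int. \<bar>real_of_int i\<bar>
          \<le> Q}. cmod (fourier_coeff1 (\<mu>s j) \<xi>)) \<le> C * Q powr (1 - s))"
    if "j < k" for j
    using l1dim1_gtE[OF \<mu>P[OF that] dim[OF that]] by metis
  then obtain s C where s: "\<And>j. j < k
      \<Longrightarrow> s j > 1 - 1 / (real k + 1)" and C0: "\<And>j. j < k
          \<Longrightarrow> C j \<ge> 0"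
    and C: "\<And>j Q. j < k \<Longrightarrow> Q \<ge> 1 \<Longrightarrow>
      (\<Sum>\<xi>\<in>{i::int. \<bar>real_of_int i\<bar>
          \<le> Q}. cmod (fourier_coeff1 (\<mu>s j) \<xi>)) \<le> C j * Q powr (1 - s j)"
    by metis
  \<comment> \<open>One exponent for all coordinates; as a maximum of finitely many numbers below
    1/(k+1) it stays strictly below.\<close>
  define \<tau> where "\<tau> = Max (insert 0 ((\<lambda>j. 1 - s j) ` {..<k}))"
  have \<tau>0: "\<tau> \<ge> 0" by (simp add: \<tau>_def)
  have \<tau>s: "1 - s j \<le> \<tau>" if "j < k" for j using that by (simp add: \<tau>_def)
  have "\<tau> < 1 / (real k + 1)" using s by (force simp: \<tau>_def)
  then have \<tau>1: "\<tau> * (real k + 1) < 1" by (simp add: field_simps)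
  define D where "D = (\<Prod>j<k. C j)"
  have D0: "D \<ge> 0" unfolding D_def using C0 by (intro prod_nonneg) auto
  \<comment> \<open>This is where the product structure enters: the sum over a box factors into
    one-dimensional sums, so boxes of every shape obey the bound.\<close>
  have spec: "(\<Sum>\<xi>\<in>freq_box k l. cmod (fourier_coeff k M \<xi>))
      \<le> D * 2 powr (\<tau> * real (\<Sum>j<k. l j))" for l
  proof -
    have "(\<Sum>\<xi>\<in>freq_box k l. cmod (fourier_coeff k M \<xi>))
        = (\<Sum>\<xi>\<in>freq_box k l. \<Prod>j<k. cmod (fourier_coeff1 (\<mu>s j) (\<xi> j)))"
      unfolding M_def using \<mu>P \<mu>S by (simp add: fourier_coeff_PiM prod_norm)
    also have "\<dots> = (\<Prod>j<k. \<Sum>\<xi>\<in>{- (2 ^ l j)..2 ^ l j}. cmod (fourier_coeff1 (\<mu>s j) \<xi>))"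
      unfolding freq_box_def by (rule prod_sum_PiE[symmetric]) auto
    also have "\<dots> \<le> (\<Prod>j<k. C j * 2 powr (\<tau> * real (l j)))"
    proof (rule prod_mono, rule conjI)
      fix j assume j: "j \<in> {..<k}"
      show "0 \<le> (\<Sum>\<xi>\<in>{- (2 ^ l j)..2 ^ l j}. cmod (fourier_coeff1 (\<mu>s j) \<xi>))"
        by (intro sum_nonneg) auto
      have "(\<Sum>\<xi>\<in>{- (2 ^ l j)..2 ^ l j}. cmod (fourier_coeff1 (\<mu>s j) \<xi>))
          \<le> C j * (2 ^ l j) powr (1 - s j)"
        unfolding dyadic_interval_eq using j by (intro C) auto
      also have "\<dots> \<le> C j * (2 ^ l j) powr \<tau>"
        using j C0 \<tau>s by (intro mult_left_mono powr_mono) auto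
      also have "(2 ^ l j) powr \<tau> = 2 powr (real (l j) * \<tau>)"
        by (simp only: powr_realpow[symmetric] powr_powr zero_less_numeral)
      finally show "(\<Sum>\<xi>\<in>{- (2 ^ l j)..2 ^ l j}. cmod (fourier_coeff1 (\<mu>s j) \<xi>))
          \<le> C j * 2 powr (\<tau> * real (l j))"
        by (simp add: mult.commute)
    qed
    also have "\<dots> = D * 2 powr (\<tau> * real (\<Sum>j<k. l j))"
      by (simp add: prod.distrib D_def powr_sum sum_distrib_left)
    finally show ?thesis .
  qed
  obtain \<epsilon> K where \<epsilon>: "\<epsilon> > 0" "\<epsilon>
      \<le> 1" and K0: "K \<ge> 0" and K:
    "\<And>m l y. \<lbrakk>real (\<Sum>j<k. l j) \<le> (1 + \<epsilon>) * real m;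
       (\<Sum>\<xi>\<in>freq_box k (\<lambda>j. l j + (m + 1)). cmod (fourier_coeff k M \<xi>))
         \<le> D * 2 powr (\<tau> * real (\<Sum>j<k. l j + (m + 1)))\<rbrakk>
     \<Longrightarrow> (\<Sum>n\<in>{2^m..<2^(m+1)}. measure M (near_event k y n l))
         \<le> K * (2 ^ m / 2 ^ (\<Sum>j<k. l j))"
    using block_sum_near_event_le[OF P S \<tau>0 \<tau>1 D0] by metis
  have "summable (\<lambda>n. \<psi> n ^ 1 * ln (real n) ^ (k - 1))" using sum by simp
  then obtain r where r: "\<And>m. \<psi> (2 ^ m) \<le> 1 / 2 ^ r m" "\<And>m. real (1 * r m)
      \<le> (1 + \<epsilon>) * real m"
    "summable (\<lambda>m. real m ^ (k - 1) * (2 ^ m / 2 ^ (1 * r m)))"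
    using dyadic_scale[OF _ _ \<psi>(2) _ order_refl \<epsilon>(1), of "k - 1"] \<psi>(1) by blast
  \<comment> \<open>The exponent sum delivered by \<open>small_product_dyadic_box\<close>.\<close>
  define R where "R m = r m - 4 * k" for m
  define A where "A n = {x \<in> space M. n \<ge> 1 \<and> (\<Prod>j<k. dist_nint (real n * x j - y j)) < \<psi> n}" for n
  have "limsup A \<in> null_sets M"
  proof (rule limsup_null_if_dyadic_cover[OF P S, where y = y and LL
      = "\<lambda>m. compositions k (R m)"
        and b = "\<lambda>m. K * (2 ^ m / 2 ^ R m)"])
    show "A n \<in> sets M" for n
    proof -
      have "(\<lambda>x. dist_nint (real n * x j - y j)) \<in> borel_measurable M" if "j \<in> {..<k}" for j
        using that measurable_dist_nint_component[of j k n y]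
            by (simp add: measurable_cong_sets[OF S refl])
      then have [measurable]: "(\<lambda>x. \<Prod>j<k. dist_nint (real n * x j - y j)) \<in> borel_measurable M"
        by (intro borel_measurable_prod)
      show ?thesis unfolding A_def by measurable
    qed
    show "A n \<subseteq> (\<Union>l\<in>compositions k (R m). near_event k y n l)" if "2 ^ m
        \<le> n" "n < 2 ^ (m + 1)" for m n
    proof
      fix x assume x: "x \<in> A n"
      have "\<psi> n \<le> \<psi> (2 ^ m)" using that \<psi>(2) by (auto simp: antimono_def)
      then have "(\<Prod>j<k. dist_nint (real n * x j - y j)) < 1 / 2 ^ r m"
        using r(1)[of m] x by (auto simp: A_def)
      then obtain l where "l \<in> compositions k (R m)"
        "\<forall>j<k. l j = 0 \<or> dist_nint (real n * x j - y j) \<le> 1 / 2 ^ (l j + 3)"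
        using small_product_dyadic_box[of k "\<lambda>j. dist_nint (real n * x j - y j)" "r m"]
        by (auto simp: R_def dist_nint_def)
      moreover have "x \<in> PiE {..<k} (\<lambda>_. UNIV)"
        using x sets_eq_imp_space_eq[OF S] by (auto simp: A_def space_PiM)
      ultimately show "x \<in> (\<Union>l\<in>compositions k (R m). near_event k y n l)"
        by (auto simp: near_event_def)
    qed
    show "(\<Sum>n\<in>{2^m..<2^(m+1)}. measure M (near_event k y n l)) \<le> K * (2 ^ m / 2 ^ R m)"
      if "l \<in> compositions k (R m)" for m l
    proof -
      have sum_l: "(\<Sum>j<k. l j) = R m" using that by (simp add: compositions_def)
      have "real (\<Sum>j<k. l j) \<le> (1 + \<epsilon>) * real m"
        unfolding sum_l using r(2)[of m] by (simp add: R_def)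
      then show ?thesis using K[of l m y] spec[of "\<lambda>j. l j + (m + 1)"] unfolding sum_l
          by blast
    qed
    \<comment> \<open>The number of boxes grows like m^(k-1), which the logarithmic weight of the
      given series absorbs. The constant 3^(k-1) comes from R m + 1 \<le> 3m, using \<epsilon> \<le>
      1, and 2^(4k) from R m \<ge> r m - 4k.\<close>
    have "summable (\<lambda>m. 3 ^ (k - 1) * (K * 2 ^ (4 * k)) * (real m ^ (k - 1) * (2 ^ m / 2 ^ r m)))"
      using r(3) by (intro summable_mult) simp
    then show "summable (\<lambda>m. real (card (compositions k (R m))) * (K * (2 ^ m / 2 ^ R m)))"
    proof (rule summable_comparison_test[rotated], intro exI[of _ 1] allI impI)
      fix m :: nat assume m: "m \<ge> 1"
      have "real (R m) \<le> (1 + \<epsilon>) * real m" using r(2)[of m] by (simp add: R_def)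
      also have "\<dots> \<le> 2 * real m" using \<epsilon>(2) by (intro mult_right_mono) auto
      finally have Rm: "real (R m + 1) \<le> 3 * real m" using m by simp
      have "real (card (compositions k (R m))) \<le> real ((R m + 1) ^ (k - 1))"
        using card_compositions_le[OF k] by (simp only: of_nat_le_iff)
      also have "\<dots> = real (R m + 1) ^ (k - 1)" by simp
      also have "\<dots> \<le> (3 * real m) ^ (k - 1)" using Rm by (intro power_mono) auto
      finally have card: "real (card (compositions k (R m))) \<le> 3 ^ (k - 1) * real m ^ (k - 1)"
        by (simp add: power_mult_distrib)
      have "(2::real) ^ r m \<le> 2 ^ (4 * k + R m)" by (intro power_increasing) (auto simp: R_def)
      then have "1 / 2 ^ R m \<le> (2 ^ (4 * k) / 2 ^ r m :: real)"
        by (simp only: power_add) (simp add: field_simps)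
      then have "(K * 2 ^ m) * (1 / 2 ^ R m) \<le> (K * 2 ^ m) * (2 ^ (4 * k) / 2 ^ r m)"
        using K0 by (intro mult_left_mono) auto
      then have "K * (2 ^ m / 2 ^ R m) \<le> K * 2 ^ (4 * k) * (2 ^ m / 2 ^ r m)"
        by (simp add: mult_ac)
      from mult_mono[OF card this]
      have "real (card (compositions k (R m))) * (K * (2 ^ m / 2 ^ R m))
          \<le> 3 ^ (k - 1) * real m ^ (k - 1) * (K * 2 ^ (4 * k) * (2 ^ m / 2 ^ r m))"
        using K0 by simp
      then show "norm (real (card (compositions k (R m))) * (K * (2 ^ m / 2 ^ R m)))
          \<le> 3 ^ (k - 1) * (K * 2 ^ (4 * k)) * (real m ^ (k - 1) * (2 ^ m / 2 ^ r m))"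
        using K0 by (simp add: mult_ac)
    qed
  qed simp
  then have "W_mult_set k \<psi> y \<in> null_sets M"
    unfolding W_mult_set_def by (rule null_sets_infinitely_often[OF S]) (simp add: A_def)
  then show "W_mult_set k \<psi> y \<in> null_sets (PiM {..<k} \<mu>s)" by (simp add: M_def)
qed

theorem theorem1p8:
  fixes k :: nat
  assumes "k \<ge> 1"
  shows "(\<forall>M. borel_prob_cube k M \<and> l1dim k M > real k - real k / (real k + 1)
            \<longrightarrow> inhom_conv_khinchin k M)
       \<and> (\<forall>\<mu>s :: nat \<Rightarrow> real measure.
            (\<forall>j<k. borel_prob_unit (\<mu>s j) \<and> l1dim1 (\<mu>s j) > 1 - 1 / (real k + 1))
            \<longrightarrow> inhom_conv_gallagher k (PiM {..<k} \<mu>s))"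
  using inhom_conv_khinchin_if_l1dim[OF assms] inhom_conv_gallagher_if_l1dim1[OF assms] by blast

end
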